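(* Let $P(\lambda)=\sum_{i=0}^m\lambda^iA_i$ with $A_i\in\mathbb{C}^{n\times n}$, $A_m\neq 0$, $m\ge 2$, and let $$L(\lambda)=M_{\tau_1}(Y_1)\,M_{\sigma_1}(X_1)\,(\lambda M^P_\tau-M^P_\sigma)\,M_{\sigma_2}(X_2)\,M_{\tau_2}(Y_2)$$ be an extended generalized Fiedler pencil (EGFP) of $P(\lambda)$. If all the matrix assignments $X_j$ and $Y_j$, $j=1,2$, are nonsingular, then $L(\lambda)$ is a strong linearization of $P(\lambda)$.
   Context: Notation: $\{0:m\}=\{0,1,\dots,m\}$, $-\{0:m\}=\{-m,\dots,-1,-0\}$, where $-0$ is a formal index different from $0$ (the successor of $-1$). Index tuples: an index tuple is a finite, possibly empty, tuple of indices. $(\alpha,\beta)$ denotes concatenation and $-\alpha$ negates all entries. A tuple $(i_1,\dots,i_t)$ satisfies the Successor Infix Property (SIP) if whenever $a<b$ and $i_a=i_b$ there is $c$ with $a<c<b$ and $i_c=i_a+1$ (for tuples from $-\{0:m\}$ this is understood after shifting by $m$, so $-0$ is the successor of $-1$). Elementary matrices (of size $mn\times mn$): for $X\in\mathbb{C}^{n\times n}$, $M_0(X)=\mathrm{diag}(I_{(m-1)n},X)$, $M_{-m}(X)=\mathrm{diag}(X,I_{(m-1)n})$, and for $i=1,\dots,m-1$ $$M_i(X)=\mathrm{diag}\Big(I_{(m-i-1)n},\begin{bmatrix}X & I_n \\ I_n & 0\end{bmatrix},I_{(i-1)n}\Big),\quad M_{-i}(X)=\mathrm{diag}\Big(I_{(m-i-1)n},\begin{bmatrix}0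 & I_n \\ I_n & X\end{bmatrix},I_{(i-1)n}\Big).$$ $M_i^P=M_i(-A_i)$ for $0\le i\le m-1$, $M_{-i}^P=M_{-i}(A_i)$ for $1\le i\le m$, $M_{-0}^P=(M_0^P)^{-1}$, $M_m^P=(M_{-m}^P)^{-1}$ (the last two are used only when $A_0$, respectively $A_m$, is invertible). For a tuple $\mathbf t=(t_1,\dots,t_r)$, $M_{\mathbf t}^P=M_{t_1}^P\cdots M_{t_r}^P$; a matrix assignment for $\mathbf t$ is a tuple $X=(X_1,\dots,X_r)$ of $n\times n$ complex matrices, and $M_{\mathbf t}(X)=M_{t_1}(X_1)\cdots M_{t_r}(X_r)$. Empty products equal $I_{mn}$. An assignment is nonsingular if the matrices assigned to positions occupied by indices $\pm0,\pm m$ are nonsingular. EGFP: let $(\sigma,\omega)$ be a permutation of $\{0:m\}$ and $\tau=-\omega$. Let $\sigma_1,\sigma_2$ be index tuples with indices from $\sigma\setminus\{m-1,m\}$ such that $(\sigma_1,\sigma,\sigma_2)$ satisfies the SIP, and $\tau_1,\tau_2$ index tuples with indices from $\tau\setminus\{-1,-0\}$ such that $(\tau_1,\tau,\tau_2)$ satisfies the SIP. Let $X_1,X_2,Y_1,Y_2$ be arbitrary nonsingular matrix assignments for $\sigma_1,\sigma_2,\tau_1,\tau_2$. Then $M_{\tau_1}(Y_1)M_{\sigma_1}(X_1)(\lambda M^P_\tau-M^P_\sigma)M_{\sigma_2}(X_2)M_{\tau_2}(Y_2)$ is an EGFP of $P(\lambda)$. Strong linearization: an $mn\times mn$ pencil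 $L(\lambda)=\mathcal X+\lambda\mathcal Y$ is a linearization of $P(\lambda)$ if there are $mn\times mn$ unimodular matrix polynomials $U(\lambda),V(\lambda)$ (with nonzero constant determinants) such that $U(\lambda)L(\lambda)V(\lambda)=\mathrm{diag}(I_{(m-1)n},P(\lambda))$. It is strong if in addition $\mathrm{rev}L(\lambda)=\mathcal Y+\lambda\mathcal X$ is a linearization of $\mathrm{rev}P(\lambda)=\lambda^mP(1/\lambda)$. *)

theory Defs
  imports
    "Jordan_Normal_Form.Determinant"
    "Jordan_Normal_Form.Gauss_Jordan_Elimination"
begin

text \<open>Matrix polynomials are matrices over \<open>complex poly\<close>.\<close>

definition mat_polynomial :: "nat \<Rightarrow> nat \<Rightarrow> (nat \<Rightarrow> complex mat) \<Rightarrow> complex poly mat" where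
  "mat_polynomial n m A = mat n n (\<lambda>(i, j). \<Sum>k\<le>m. monom (A k $$ (i, j)) k)"

definition const_mat :: "complex mat \<Rightarrow> complex poly mat" where
  "const_mat A = map_mat (\<lambda>a. [:a:]) A"

text \<open>The pencil \<open>X + \<lambda>Y\<close>; \<open>[:0, 1:]\<close> is the indeterminate \<open>\<lambda>\<close>.\<close>

definition pencil :: "complex mat \<Rightarrow> complex mat \<Rightarrow> complex poly mat" where
  "pencil X Y = const_mat X + [:0, 1:] \<cdot>\<^sub>m const_mat Y"

text \<open>Reversal is taken with respect to a grade \<open>d\<close> that bounds the degree but need not equal
  the degree of any single entry, so \<open>reflect_poly\<close> is not applicable.\<close>

definition rev_poly :: "nat \<Rightarrow> complex poly \<Rightarrow> complex poly" where
  "rev_poly d p = (\<Sum>k\<le>d. monom (coeff p k) (d - k))"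

lemma poly_rev_poly:
  assumes "degree p \<le> d" and "x \<noteq> 0"
  shows "poly (rev_poly d p) x = x ^ d * poly p (1 / x)"
proof -
  have "poly p (1 / x) = (\<Sum>k\<le>d. coeff p k * (1 / x) ^ k)"
    unfolding poly_altdef using assms(1)
    by (intro sum.mono_neutral_left) (auto simp: coeff_eq_0)
  then have "x ^ d * poly p (1 / x) = (\<Sum>k\<le>d. x ^ d * (coeff p k * (1 / x) ^ k))"
    by (simp only: sum_distrib_left)
  moreover have "x ^ d * (coeff p k * (1 / x) ^ k) = coeff p k * x ^ (d - k)" if "k \<le> d" for k
    using that assms(2) by (simp add: power_diff power_one_over field_simps)
  ultimately show ?thesis
    unfolding rev_poly_def poly_sum poly_monom by (metis (no_types, lifting) atMost_iff sum.cong)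
qed

definition rev_mat :: "nat \<Rightarrow> complex poly mat \<Rightarrow> complex poly mat" where
  "rev_mat d Q = map_mat (rev_poly d) Q"

lemma rev_mat_pencil:
  assumes "X \<in> carrier_mat r c" and "Y \<in> carrier_mat r c"
  shows "rev_mat 1 (pencil X Y) = pencil Y X"
  using assms
  by (intro eq_matI)
     (auto simp: rev_mat_def rev_poly_def pencil_def const_mat_def monom_altdef)

definition unimodular :: "nat \<Rightarrow> complex poly mat \<Rightarrow> bool" where
  "unimodular N U \<longleftrightarrow> U \<in> carrier_mat N N \<and> (\<exists>c. c \<noteq> 0 \<and> det U = [:c:])"

text \<open>\<open>linearization m n P L\<close>: the pencil \<open>L\<close> is a linearization of the \<open>n \<times> n\<close> matrix
  polynomial \<open>P\<close> of grade \<open>m\<close>.\<close>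

definition linearization ::
  "nat \<Rightarrow> nat \<Rightarrow> complex poly mat \<Rightarrow> complex poly mat \<Rightarrow> bool" where
  "linearization m n P L \<longleftrightarrow>
    (\<exists>X \<in> carrier_mat (m * n) (m * n). \<exists>Y \<in> carrier_mat (m * n) (m * n). L = pencil X Y) \<and>
    (\<exists>U V. unimodular (m * n) U \<and> unimodular (m * n) V \<and>
      U * L * V = diag_block_mat [1\<^sub>m ((m - 1) * n), P])"

definition strong_linearization ::
  "nat \<Rightarrow> nat \<Rightarrow> complex poly mat \<Rightarrow> complex poly mat \<Rightarrow> bool" where
  "strong_linearization m n P L \<longleftrightarrow>
    linearization m n P L \<and> linearization m n (rev_mat m P) (rev_mat 1 L)"

text \<open>\<open>Pos k\<close> and \<open>Neg k\<close> stand for \<open>k\<close> and \<open>-k\<close>; in particular \<open>Neg 0\<close> is the formal index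
  \<open>-0\<close>, distinct from \<open>Pos 0\<close>.\<close>

datatype idx = Pos nat | Neg nat

fun neg_idx :: "idx \<Rightarrow> idx" where
  "neg_idx (Pos k) = Neg k"
| "neg_idx (Neg k) = Pos k"

text \<open>\<open>is_succ i j\<close> says that \<open>j\<close> is the successor of \<open>i\<close>. The successor of \<open>-1\<close> is \<open>-0\<close>, and \<open>-0\<close>
  has no successor: after the shift by \<open>m\<close> it would be \<open>m + 1\<close>, which is not an index of a tuple
  from \<open>-{0:m}\<close>.\<close>

fun is_succ :: "idx \<Rightarrow> idx \<Rightarrow> bool" where
  "is_succ (Pos a) (Pos b) \<longleftrightarrow> b = Suc a"
| "is_succ (Neg a) (Neg b) \<longleftrightarrow> a = Suc b"
| "is_succ _ _ \<longleftrightarrow> False"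

definition SIP :: "idx list \<Rightarrow> bool" where
  "SIP t \<longleftrightarrow> (\<forall>a b. a < b \<and> b < length t \<and> t ! a = t ! b \<longrightarrow>
    (\<exists>c. a < c \<and> c < b \<and> is_succ (t ! a) (t ! c)))"

text \<open>The intended domain is \<open>Pos k\<close> with \<open>k < m\<close> and \<open>Neg k\<close> with \<open>1 \<le> k \<le> m\<close>. The indices
  \<open>Pos m\<close> and \<open>Neg 0\<close> never carry an arbitrary matrix, and the values there (the result of
  truncated subtraction) are irrelevant.\<close>

fun elem_mat :: "nat \<Rightarrow> nat \<Rightarrow> idx \<Rightarrow> complex mat \<Rightarrow> complex mat" where
  "elem_mat m n (Pos k) X =
    (if k = 0 then diag_block_mat [1\<^sub>m ((m - 1) * n), X]
     else diag_block_mat [1\<^sub>m ((m - k - 1) * n),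
            four_block_mat X (1\<^sub>m n) (1\<^sub>m n) (0\<^sub>m n n), 1\<^sub>m ((k - 1) * n)])"
| "elem_mat m n (Neg k) X =
    (if k = m then diag_block_mat [X, 1\<^sub>m ((m - 1) * n)]
     else diag_block_mat [1\<^sub>m ((m - k - 1) * n),
            four_block_mat (0\<^sub>m n n) (1\<^sub>m n) (1\<^sub>m n) X, 1\<^sub>m ((k - 1) * n)])"

text \<open>The matrices \<open>M\<^sub>i\<^sup>P\<close>. The two inverses are meaningful only if \<open>A m\<close>, respectively \<open>A 0\<close>, is
  invertible.\<close>

fun fiedler_mat :: "nat \<Rightarrow> nat \<Rightarrow> (nat \<Rightarrow> complex mat) \<Rightarrow> idx \<Rightarrow> complex mat" where
  "fiedler_mat m n A (Pos k) =
    (if k = m then the (mat_inverse (elem_mat m n (Neg m) (A m)))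
     else elem_mat m n (Pos k) (- A k))"
| "fiedler_mat m n A (Neg k) =
    (if k = 0 then the (mat_inverse (elem_mat m n (Pos 0) (- A 0)))
     else elem_mat m n (Neg k) (A k))"

definition mat_prod :: "nat \<Rightarrow> complex mat list \<Rightarrow> complex mat" where
  "mat_prod N Ms = foldr (*) Ms (1\<^sub>m N)"

definition fiedler_prod ::
  "nat \<Rightarrow> nat \<Rightarrow> (nat \<Rightarrow> complex mat) \<Rightarrow> idx list \<Rightarrow> complex mat" where
  "fiedler_prod m n A t = mat_prod (m * n) (map (fiedler_mat m n A) t)"

definition elem_prod :: "nat \<Rightarrow> nat \<Rightarrow> idx list \<Rightarrow> complex mat list \<Rightarrow> complex mat" where
  "elem_prod m n t X = mat_prod (m * n) (map2 (elem_mat m n) t X)"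

definition matrix_assignment :: "nat \<Rightarrow> idx list \<Rightarrow> complex mat list \<Rightarrow> bool" where
  "matrix_assignment n t X \<longleftrightarrow> length X = length t \<and> set X \<subseteq> carrier_mat n n"

definition nonsingular_assignment :: "nat \<Rightarrow> idx list \<Rightarrow> complex mat list \<Rightarrow> bool" where
  "nonsingular_assignment m t X \<longleftrightarrow>
    (\<forall>k < length t. t ! k \<in> {Pos 0, Neg 0, Pos m, Neg m} \<longrightarrow> invertible_mat (X ! k))"

text \<open>Invertibility of \<open>A m\<close> and \<open>A 0\<close> is demanded exactly when \<open>M\<^sub>m\<^sup>P\<close>, respectively \<open>M\<^sub>-\<^sub>0\<^sup>P\<close>,
  occurs in the pencil.\<close>

definition EGFP ::
  "nat \<Rightarrow> nat \<Rightarrow> (nat \<Rightarrow> complex mat) \<Rightarrow> idx list \<Rightarrow> idx list \<Rightarrow>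
   idx list \<Rightarrow> idx list \<Rightarrow> idx list \<Rightarrow> idx list \<Rightarrow>
   complex mat list \<Rightarrow> complex mat list \<Rightarrow> complex mat list \<Rightarrow> complex mat list \<Rightarrow>
   complex poly mat \<Rightarrow> bool" where
  "EGFP m n A \<sigma> \<tau> \<sigma>1 \<sigma>2 \<tau>1 \<tau>2 X1 X2 Y1 Y2 L \<longleftrightarrow>
    (\<exists>\<omega>. distinct (\<sigma> @ \<omega>) \<and> set (\<sigma> @ \<omega>) = Pos ` {0..m} \<and> \<tau> = map neg_idx \<omega>) \<and>
    (Pos m \<in> set \<sigma> \<longrightarrow> invertible_mat (A m)) \<and>
    (Neg 0 \<in> set \<tau> \<longrightarrow> invertible_mat (A 0)) \<and>
    set \<sigma>1 \<subseteq> set \<sigma> - {Pos (m - 1), Pos m} \<and>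
    set \<sigma>2 \<subseteq> set \<sigma> - {Pos (m - 1), Pos m} \<and>
    SIP (\<sigma>1 @ \<sigma> @ \<sigma>2) \<and>
    set \<tau>1 \<subseteq> set \<tau> - {Neg 1, Neg 0} \<and>
    set \<tau>2 \<subseteq> set \<tau> - {Neg 1, Neg 0} \<and>
    SIP (\<tau>1 @ \<tau> @ \<tau>2) \<and>
    matrix_assignment n \<sigma>1 X1 \<and> matrix_assignment n \<sigma>2 X2 \<and>
    matrix_assignment n \<tau>1 Y1 \<and> matrix_assignment n \<tau>2 Y2 \<and>
    nonsingular_assignment m \<sigma>1 X1 \<and> nonsingular_assignment m \<sigma>2 X2 \<and>
    nonsingular_assignment m \<tau>1 Y1 \<and> nonsingular_assignment m \<tau>2 Y2 \<and>
    L = const_mat (elem_prod m n \<tau>1 Y1) * const_mat (elem_prod m n \<sigma>1 X1) *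
        ([:0, 1:] \<cdot>\<^sub>m const_mat (fiedler_prod m n A \<tau>) - const_mat (fiedler_prod m n A \<sigma>)) *
        const_mat (elem_prod m n \<sigma>2 X2) * const_mat (elem_prod m n \<tau>2 Y2)"

end

theory Submission
  imports Defs
begin

text \<open>
  Why the theorem holds. The outer factors of an EGFP are invertible constant matrices: an
  elementary matrix \<open>M\<^sub>\<plusminus>\<^sub>i(X)\<close> with \<open>0 < i < m\<close> is invertible for every \<open>X\<close>, and at the two ends
  invertibility is inherited from \<open>X\<close>. So \<open>L\<close> is strictly equivalent to \<open>\<lambda>M\<^sub>\<tau> - M\<^sub>\<sigma>\<close>. Every factor
  \<open>M\<^sub>i\<close> may be carried to the other side of the pencil as \<open>M\<^sub>-\<^sub>i\<close> as long as it is invertible, and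
  this suffices to collect all factors except \<open>M\<^sub>-\<^sub>m\<close> in the constant term
  (\<open>gfp_strictly_equivalent\<close>). What remains is a Fiedler pencil \<open>\<lambda>M\<^sub>-\<^sub>m - M\<^sub>\<rho>\<close> with \<open>\<rho>\<close> a permutation
  of \<open>0, ..., m - 1\<close>.

  For Fiedler pencils, induct on \<open>m\<close>. The factor \<open>M\<^sub>m\<^sub>-\<^sub>1\<close> commutes with every other factor except
  \<open>M\<^sub>m\<^sub>-\<^sub>2\<close>, so it can be moved to the left or the right end of \<open>M\<^sub>\<rho>\<close> and cancelled by its inverse.
  The leading diagonal block of the result is \<open>-I\<close>, and its Schur complement is again a Fiedler
  pencil, with one block row less and with leading coefficient \<open>A\<^sub>m\<^sub>-\<^sub>1 + \<lambda>A\<^sub>m\<close>. This is one step of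
  Horner's scheme; after the last step only \<open>P(\<lambda>)\<close> is left (\<open>fiedler_pencil_horner\<close>). The induction
  needs a leading coefficient that is itself a matrix polynomial.

  Reversal needs no second elimination. Strict equivalence acts on both coefficients alike, so it
  respects reversal and leaves the pencil \<open>M\<^sub>-\<^sub>m - \<lambda>M\<^sub>\<rho>\<close>. Here all factors but \<open>M\<^sub>0\<close> are collected in
  the constant term. Reversing the order of all rows and of all columns turns \<open>M\<^sub>-\<^sub>i\<close> into \<open>M\<^sub>m\<^sub>-\<^sub>i\<close> and
  \<open>M\<^sub>0\<close> into \<open>M\<^sub>-\<^sub>m\<close>, and so yields, up to sign, a Fiedler pencil of the flipped polynomial
  \<open>-rev P\<close> (\<open>fiedler_pencil_reversal_reduces\<close>).
\<close>

section \<open>Block diagonal sums and elementary matrices\<close>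

text \<open>A binary block diagonal sum. As a binary operation it is associative, so
  the block partition can be moved to where a product needs it.\<close>

definition dsum :: "'a::zero mat \<Rightarrow> 'a mat \<Rightarrow> 'a mat" (infixr \<open>\<oplus>\<^sub>d\<close> 65) where
  "A \<oplus>\<^sub>d D = four_block_mat A (0\<^sub>m (dim_row A) (dim_col D)) (0\<^sub>m (dim_row D) (dim_col A)) D"

lemma dsum_carrier [simp]:
  "A \<in> carrier_mat a b \<Longrightarrow> D \<in> carrier_mat c d \<Longrightarrow> A \<oplus>\<^sub>d D \<in> carrier_mat (a + c) (b + d)"
  by (auto simp: dsum_def)

lemma dsum_dim [simp]:
  "dim_row (A \<oplus>\<^sub>d D) = dim_row A + dim_row D" "dim_col (A \<oplus>\<^sub>d D) = dim_col A + dim_col D"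
  by (auto simp: dsum_def)

lemma dsum_assoc: "(A \<oplus>\<^sub>d B) \<oplus>\<^sub>d C = A \<oplus>\<^sub>d (B \<oplus>\<^sub>d C)"
  using assoc_four_block_mat[of A B C] by (simp add: dsum_def)

lemma dsum_one: "1\<^sub>m a \<oplus>\<^sub>d 1\<^sub>m b = 1\<^sub>m (a + b)"
  by (simp add: dsum_def)

lemma dsum_empty [simp]: "1\<^sub>m 0 \<oplus>\<^sub>d A = A" "A \<oplus>\<^sub>d 1\<^sub>m 0 = A"
  by (auto simp: dsum_def intro!: eq_matI)

lemma dsum_mult:
  fixes A1 A2 D1 D2 :: "'a::semiring_1 mat"
  assumes "A1 \<in> carrier_mat a a" "A2 \<in> carrier_mat a a"
    and "D1 \<in> carrier_mat d d" "D2 \<in> carrier_mat d d"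
  shows "(A1 \<oplus>\<^sub>d D1) * (A2 \<oplus>\<^sub>d D2) = A1 * A2 \<oplus>\<^sub>d D1 * D2"
  using assms
  by (simp add: dsum_def mult_four_block_mat[of A1 a a "0\<^sub>m a d" d "0\<^sub>m d a" d D1
        A2 a "0\<^sub>m a d" d "0\<^sub>m d a" D2])

lemma diag_block_mat_eq_dsum:
  "diag_block_mat [A, B] = A \<oplus>\<^sub>d B" "diag_block_mat [A, B, C] = A \<oplus>\<^sub>d B \<oplus>\<^sub>d C"
proof -
  show "diag_block_mat [A, B] = A \<oplus>\<^sub>d B" for A B :: "'a mat"
    using diag_block_mat_append[of "[A]" "[B]"] by (simp only: append.simps Let_def dsum_def diag_block_mat_singleton)
  note two = this
  show "diag_block_mat [A, B, C] = A \<oplus>\<^sub>d B \<oplus>\<^sub>d C"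
    using diag_block_mat_append[of "[A]" "[B,C]"] by (simp only: append.simps Let_def dsum_def diag_block_mat_singleton two)
qed

text \<open>The active blocks of the elementary matrices \<open>M\<^sub>i(X)\<close> and \<open>M\<^sub>-\<^sub>i(X)\<close> for \<open>0 < i < m\<close>.\<close>

definition swap_block :: "nat \<Rightarrow> complex mat \<Rightarrow> complex mat" where
  "swap_block n X = four_block_mat X (1\<^sub>m n) (1\<^sub>m n) (0\<^sub>m n n)"

definition swap_block_inv :: "nat \<Rightarrow> complex mat \<Rightarrow> complex mat" where
  "swap_block_inv n X = four_block_mat (0\<^sub>m n n) (1\<^sub>m n) (1\<^sub>m n) X"

lemma swap_block_carrier [simp]:
  assumes "X \<in> carrier_mat n n"
  shows "swap_block n X \<in> carrier_mat (n + n) (n + n)"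
    and "swap_block_inv n X \<in> carrier_mat (n + n) (n + n)"
  using assms by (auto simp: swap_block_def swap_block_inv_def)

text \<open>This is why an inner elementary matrix is invertible whatever its argument is, and why
  \<open>M\<^sub>-\<^sub>i\<^sup>P = M\<^sub>-\<^sub>i(A\<^sub>i)\<close> is the inverse of \<open>M\<^sub>i\<^sup>P = M\<^sub>i(-A\<^sub>i)\<close>.\<close>

lemma swap_block_inverse:
  assumes "X \<in> carrier_mat n n"
  shows "swap_block n X * swap_block_inv n (- X) = 1\<^sub>m (n + n)"
    and "swap_block_inv n (- X) * swap_block n X = 1\<^sub>m (n + n)"
proof -
  have "X + - X = 0\<^sub>m n n" "- X + X = 0\<^sub>m n n" "1\<^sub>m n + - 0\<^sub>m n n = (1\<^sub>m n :: complex mat)"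
    using assms by (auto intro!: eq_matI)
  then show "swap_block n X * swap_block_inv n (- X) = 1\<^sub>m (n + n)"
    and "swap_block_inv n (- X) * swap_block n X = 1\<^sub>m (n + n)"
    using assms
    by (simp_all add: swap_block_def swap_block_inv_def mult_four_block_mat[of _ n n _ n _ n _ _ n _ n])
qed

lemma elem_mat_Pos: "elem_mat m n (Pos k) X = (if k = 0 then 1\<^sub>m ((m - 1) * n) \<oplus>\<^sub>d X
    else 1\<^sub>m ((m - k - 1) * n) \<oplus>\<^sub>d swap_block n X \<oplus>\<^sub>d 1\<^sub>m ((k - 1) * n))"
  and elem_mat_Neg: "elem_mat m n (Neg k) X = (if k = m then X \<oplus>\<^sub>d 1\<^sub>m ((m - 1) * n)
    else 1\<^sub>m ((m - k - 1) * n) \<oplus>\<^sub>d swap_block_inv n X \<oplus>\<^sub>d 1\<^sub>m ((k - 1) * n))"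
  by (simp_all only: elem_mat.simps diag_block_mat_eq_dsum swap_block_def swap_block_inv_def)

declare elem_mat.simps [simp del]

lemma block_sizes: assumes "1 \<le> k" "k < m"
  shows "(m - k - 1) * n + (n + n + (k - 1) * n) = m * (n::nat)"
proof -
  have "m = (m - k - 1) + (1 + 1 + (k - 1))" using assms by simp
  then show ?thesis by (metis add_mult_distrib nat_mult_1)
qed

lemma block_sizes1: assumes "1 \<le> m"
  shows "(m - 1) * n + n = m * (n::nat)" "n + (m - 1) * n = m * n"
  using assms by (cases m; simp)+

lemma elem_mat_carrier:
  assumes "X \<in> carrier_mat n n"
  shows "k < m \<Longrightarrow> elem_mat m n (Pos k) X \<in> carrier_mat (m * n) (m * n)"
    and "1 \<le> k \<Longrightarrow> k \<le> m \<Longrightarrow> elem_mat m n (Neg k) X \<in> carrier_mat (m * n) (m * n)"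
proof -
  have *: "1\<^sub>m ((m - k - 1) * n) \<oplus>\<^sub>d Z \<oplus>\<^sub>d 1\<^sub>m ((k - 1) * n) \<in> carrier_mat (m * n) (m * n)"
    if "Z \<in> carrier_mat (n + n) (n + n)" "1 \<le> k" "k < m" for Z :: "complex mat"
    using that block_sizes[OF that(2,3), of n]
    by (metis dsum_carrier one_carrier_mat)
  show "elem_mat m n (Pos k) X \<in> carrier_mat (m * n) (m * n)" if "k < m"
    using *[of "swap_block n X"] that assms block_sizes1[of m n]
    by (cases "k = 0"; force simp: elem_mat_Pos)
  show "elem_mat m n (Neg k) X \<in> carrier_mat (m * n) (m * n)" if "1 \<le> k" "k \<le> m"
    using *[of "swap_block_inv n X"] that assms block_sizes1[of m n]
    by (cases "k = m"; force simp: elem_mat_Neg)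
qed

lemma elem_mat_inverse:
  assumes "X \<in> carrier_mat n n" "1 \<le> k" "k < m"
  shows "elem_mat m n (Pos k) X * elem_mat m n (Neg k) (- X) = 1\<^sub>m (m * n)"
    and "elem_mat m n (Neg k) (- X) * elem_mat m n (Pos k) X = 1\<^sub>m (m * n)"
proof -
  have X: "- X \<in> carrier_mat n n" using assms by simp
  note sb = swap_block_carrier[OF assms(1)] swap_block_carrier[OF X]
  have *: "(1\<^sub>m a \<oplus>\<^sub>d Z \<oplus>\<^sub>d 1\<^sub>m b) * (1\<^sub>m a \<oplus>\<^sub>d W \<oplus>\<^sub>d 1\<^sub>m b) = 1\<^sub>m (a + (n + n + b))"
    if "Z \<in> carrier_mat (n + n) (n + n)" "W \<in> carrier_mat (n + n) (n + n)" "Z * W = 1\<^sub>m (n + n)"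
    for Z W :: "complex mat" and a b
    using that by (simp add: dsum_mult[of _ a _ _ "n + n + b"] dsum_mult[of _ "n + n" _ _ b] dsum_one)
  show "elem_mat m n (Pos k) X * elem_mat m n (Neg k) (- X) = 1\<^sub>m (m * n)"
    using assms *[OF sb(1,4) swap_block_inverse(1)] block_sizes[OF assms(2,3), of n]
    by (simp add: elem_mat_Pos elem_mat_Neg)
  show "elem_mat m n (Neg k) (- X) * elem_mat m n (Pos k) X = 1\<^sub>m (m * n)"
    using assms *[OF sb(4,1) swap_block_inverse(2)] block_sizes[OF assms(2,3), of n]
    by (simp add: elem_mat_Pos elem_mat_Neg)
qed

lemma elem_mat_end_inverse:
  assumes "X \<in> carrier_mat n n" "Y \<in> carrier_mat n n" "X * Y = 1\<^sub>m n" "1 \<le> m"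
  shows "elem_mat m n (Pos 0) X * elem_mat m n (Pos 0) Y = 1\<^sub>m (m * n)"
    and "elem_mat m n (Neg m) X * elem_mat m n (Neg m) Y = 1\<^sub>m (m * n)"
  using assms
  by (simp_all add: elem_mat_Pos elem_mat_Neg dsum_mult[of _ "(m - 1) * n" _ _ n] dsum_mult[of _ n _ _ "(m - 1) * n"]
      dsum_one block_sizes1[simplified])

text \<open>Indices count block rows from the bottom, so passing from \<open>m\<close> to \<open>m + 1\<close> only adds an identity
  block at the top left. This self-similarity drives the induction on \<open>m\<close>.\<close>

lemma elem_mat_Suc:
  assumes "k < m"
  shows "elem_mat (Suc m) n (Pos k) X = 1\<^sub>m n \<oplus>\<^sub>d elem_mat m n (Pos k) X"
proof (cases "k = 0")
  case True
  then show ?thesis using assms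
    by (simp add: elem_mat_Pos dsum_assoc[symmetric] dsum_one block_sizes1[simplified])
next
  case False
  have "Suc m - k - 1 = Suc (m - k - 1)" using assms by simp
  then have "(Suc m - k - 1) * n = n + (m - k - 1) * n" by simp
  then show ?thesis using assms False
    by (simp only: elem_mat_Pos dsum_assoc[symmetric] dsum_one if_False)
qed

lemma elem_mat_top:
  assumes "1 \<le> m"
  shows "elem_mat (Suc m) n (Pos m) X = swap_block n X \<oplus>\<^sub>d 1\<^sub>m ((m - 1) * n)"
  using assms by (simp add: elem_mat_Pos)

text \<open>The active blocks of \<open>M\<^sub>m(X)\<close> and \<open>M\<^sub>k(Y)\<close> are disjoint: the first occupies the top two block rows,
  the second lies strictly below them.\<close>

lemma elem_mat_commute:
  assumes "X \<in> carrier_mat n n" "Y \<in> carrier_mat n n" "Suc k < m"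
  shows "elem_mat (Suc m) n (Pos m) X * elem_mat (Suc m) n (Pos k) Y
    = elem_mat (Suc m) n (Pos k) Y * elem_mat (Suc m) n (Pos m) X"
proof -
  obtain p where m: "m = Suc p" "k < p" using assms(3) by (cases m) auto
  have "elem_mat (Suc m) n (Pos k) Y = 1\<^sub>m (n + n) \<oplus>\<^sub>d elem_mat p n (Pos k) Y"
    using m by (simp add: elem_mat_Suc dsum_assoc[symmetric] dsum_one)
  moreover have "elem_mat (Suc m) n (Pos m) X = swap_block n X \<oplus>\<^sub>d 1\<^sub>m (p * n)"
    using m by (simp add: elem_mat_top)
  ultimately show ?thesis
    using elem_mat_carrier(1)[OF assms(2) m(2)] swap_block_carrier(1)[OF assms(1)]
    by (simp add: dsum_mult[of _ "n + n" _ _ "p * n"])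
qed

section \<open>Unimodular reduction of matrix polynomials\<close>

interpretation const_hom: comm_ring_hom "\<lambda>a::complex. [:a:]"
  by unfold_locales auto

lemma const_mat_carrier [simp]: "A \<in> carrier_mat a b \<Longrightarrow> const_mat A \<in> carrier_mat a b"
  by (simp add: const_mat_def)

lemma const_mat_dim [simp]: "dim_row (const_mat A) = dim_row A" "dim_col (const_mat A) = dim_col A"
  by (simp_all add: const_mat_def)

lemma const_mat_mult:
  "A \<in> carrier_mat a b \<Longrightarrow> B \<in> carrier_mat b c \<Longrightarrow> const_mat (A * B) = const_mat A * const_mat B"
  unfolding const_mat_def by (rule const_hom.mat_hom_mult)

lemma const_mat_one [simp]: "const_mat (1\<^sub>m n) = 1\<^sub>m n"
  unfolding const_mat_def by (rule const_hom.mat_hom_one)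

lemma const_mat_uminus: "const_mat (- A) = - const_mat A"
  unfolding const_mat_def by (rule eq_matI) auto

lemma const_mat_dsum: "const_mat (A \<oplus>\<^sub>d D) = const_mat A \<oplus>\<^sub>d const_mat D"
  unfolding const_mat_def dsum_def by (rule eq_matI) auto

lemma pencil_carrier [simp]:
  "X \<in> carrier_mat a b \<Longrightarrow> Y \<in> carrier_mat a b \<Longrightarrow> pencil X Y \<in> carrier_mat a b"
  by (simp add: pencil_def)

lemma smult_mult_both:
  fixes Y :: "complex poly mat"
  assumes "S \<in> carrier_mat N N" "T \<in> carrier_mat N N" "X \<in> carrier_mat N N" "Y \<in> carrier_mat N N"
  shows "S * (X + c \<cdot>\<^sub>m Y) * T = S * X * T + c \<cdot>\<^sub>m (S * Y * T)"
  using assms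
  by (simp add: mult_add_distrib_mat[of _ N N _ N] add_mult_distrib_mat[of _ N N _ _ N]
     mult_smult_distrib[of _ N N _ N] mult_smult_assoc_mat[of _ N N _ N])

lemma pencil_mult:
  assumes "S \<in> carrier_mat N N" "T \<in> carrier_mat N N" "X \<in> carrier_mat N N" "Y \<in> carrier_mat N N"
  shows "const_mat S * pencil X Y * const_mat T = pencil (S * X * T) (S * Y * T)"
proof -
  have "const_mat (S * Z * T) = const_mat S * const_mat Z * const_mat T" if "Z \<in> carrier_mat N N" for Z
    using assms(1,2) that by (metis const_mat_mult mult_carrier_mat)
  then show ?thesis
    using assms by (simp only: pencil_def smult_mult_both[of _ N] const_mat_carrier)
qed

text \<open>Equivalence through unimodular factors, read from left to right. All reductions below run
  towards the normal form \<open>diag(I, P)\<close>, so inverses of unimodular matrices never have to be formed.\<close>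

definition reduces :: "nat \<Rightarrow> complex poly mat \<Rightarrow> complex poly mat \<Rightarrow> bool" where
  "reduces N L L' \<longleftrightarrow> L \<in> carrier_mat N N \<and>
    (\<exists>U V. unimodular N U \<and> unimodular N V \<and> U * L * V = L')"

lemma unimodular_mult: "unimodular N U \<Longrightarrow> unimodular N V \<Longrightarrow> unimodular N (U * V)"
proof -
  assume U: "unimodular N U" and V: "unimodular N V"
  then obtain c d where c: "U \<in> carrier_mat N N" "c \<noteq> 0" "det U = [:c:]"
    and d: "V \<in> carrier_mat N N" "d \<noteq> 0" "det V = [:d:]"
    by (auto simp: unimodular_def)
  have "det (U * V) = [:c * d:]"
    using c d by (simp add: det_mult[OF c(1) d(1)])
  then show "unimodular N (U * V)"
    using c d by (auto simp: unimodular_def)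
qed

lemma reducesI: "\<lbrakk>unimodular N U; unimodular N V; L \<in> carrier_mat N N; U * L * V = L'\<rbrakk> \<Longrightarrow> reduces N L L'"
  by (auto simp: reduces_def)

lemma reduces_trans:
  assumes "reduces N L L'" "reduces N L' L''"
  shows "reduces N L L''"
proof -
  obtain U V where 1: "unimodular N U" "unimodular N V" "U * L * V = L'" "L \<in> carrier_mat N N"
    using assms(1) by (auto simp: reduces_def)
  obtain U' V' where 2: "unimodular N U'" "unimodular N V'" "U' * L' * V' = L''"
    using assms(2) by (auto simp: reduces_def)
  have c: "U \<in> carrier_mat N N" "V \<in> carrier_mat N N" "U' \<in> carrier_mat N N" "V' \<in> carrier_mat N N"
    using 1 2 by (auto simp: unimodular_def)
  have "(U' * U) * L * (V * V') = U' * (U * L * V) * V'"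
    using c 1(4) by (simp add: assoc_mult_mat[of _ N N _ N _ N])
  then have "(U' * U) * L * (V * V') = L''"
    by (simp only: 1 2)
  then show ?thesis
    by (rule reducesI[OF unimodular_mult[OF 2(1) 1(1)] unimodular_mult[OF 1(2) 2(2)] 1(4)])
qed

lemma unimodular_const:
  assumes "S \<in> carrier_mat N N" "T \<in> carrier_mat N N" "S * T = 1\<^sub>m N"
  shows "unimodular N (const_mat S)"
proof -
  have "det S * det T = 1"
    using det_mult[OF assms(1,2)] assms(3) by simp
  then have "det S \<noteq> 0" by auto
  moreover have "det (const_mat S) = [:det S:]"
    unfolding const_mat_def by (rule const_hom.hom_det)
  ultimately show ?thesis
    unfolding unimodular_def using assms(1) by (intro conjI exI[of _ "det S"]) simp_all
qed

lemma unimodular_one: "unimodular N (1\<^sub>m N)"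
  unfolding unimodular_def by (intro conjI exI[of _ 1]) simp_all

lemma unimodular_uminus_one: "unimodular N (- 1\<^sub>m N)"
  using unimodular_const[of "- 1\<^sub>m N" N "- 1\<^sub>m N"] by (simp add: const_mat_uminus)

lemma reduces_uminus: "L \<in> carrier_mat N N \<Longrightarrow> reduces N L (- L)"
  using unimodular_uminus_one[of N] unimodular_one[of N]
  by (rule reducesI) auto

lemma unimodular_dsum:
  assumes "unimodular N U"
  shows "unimodular (k + N) (1\<^sub>m k \<oplus>\<^sub>d U)"
proof -
  have U: "U \<in> carrier_mat N N" using assms by (simp add: unimodular_def)
  then have "det (1\<^sub>m k \<oplus>\<^sub>d U) = det U"
    by (simp add: dsum_def det_four_block_mat_lower_left_zero[of _ k _ N])
  then show ?thesis using assms U by (auto simp: unimodular_def)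
qed

lemma reduces_dsum:
  assumes "reduces N L L'"
  shows "reduces (k + N) (1\<^sub>m k \<oplus>\<^sub>d L) (1\<^sub>m k \<oplus>\<^sub>d L')"
proof -
  obtain U V where 1: "unimodular N U" "unimodular N V" "U * L * V = L'" "L \<in> carrier_mat N N"
    using assms(1) by (auto simp: reduces_def)
  then have "U \<in> carrier_mat N N" "V \<in> carrier_mat N N" by (auto simp: unimodular_def)
  then show ?thesis
    using 1 by (intro reducesI[OF unimodular_dsum[OF 1(1)] unimodular_dsum[OF 1(2)]])
      (simp_all add: dsum_mult[of _ k _ _ N])
qed

text \<open>Block elimination with the pivot \<open>-I\<close> in the top left corner; \<open>D + v * u\<close> is the Schur complement.\<close>

lemma schur_reduces:
  assumes u: "u \<in> carrier_mat n k" and v: "v \<in> carrier_mat k n" and D: "D \<in> carrier_mat k k"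
  shows "reduces (n + k) (four_block_mat (- 1\<^sub>m n) u v D) (1\<^sub>m n \<oplus>\<^sub>d (D + v * u))"
proof -
  let ?U = "four_block_mat (1\<^sub>m n) (0\<^sub>m n k) v (1\<^sub>m k)"
  let ?V = "four_block_mat (- 1\<^sub>m n) u (0\<^sub>m k n) (1\<^sub>m k)"
  have "unimodular (n + k) ?U"
    unfolding unimodular_def using v
    by (intro conjI exI[of _ 1]) (simp_all add: det_four_block_mat_upper_right_zero[of _ n _ k])
  moreover have "unimodular (n + k) ?V"
  proof -
    have "det ?V = det (- 1\<^sub>m n :: complex poly mat)"
      using u by (simp add: det_four_block_mat_lower_left_zero[of _ n _ k])
    then show ?thesis using u unimodular_uminus_one[of n] by (auto simp: unimodular_def)
  qed
  moreover have "?U * four_block_mat (- 1\<^sub>m n) u v D * ?V = 1\<^sub>m n \<oplus>\<^sub>d (D + v * u)"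
  proof -
    have m1: "v * (- 1\<^sub>m n) + v = 0\<^sub>m k n"
      using v by (auto intro!: eq_matI)
    have m2: "- u + u = 0\<^sub>m n k"
      using u by (auto intro!: eq_matI)
    have m4: "- 0\<^sub>m k n = (0\<^sub>m k n :: complex poly mat)"
      by (auto intro!: eq_matI)
    have m3: "(- 1\<^sub>m n) * (- 1\<^sub>m n :: complex poly mat) = 1\<^sub>m n"
      by simp
    have "?U * four_block_mat (- 1\<^sub>m n) u v D = four_block_mat (- 1\<^sub>m n) u (0\<^sub>m k n) (v * u + D)"
      using u v D m1 by (simp add: mult_four_block_mat[of _ n n _ k _ k _ _ n _ k])
    also have "\<dots> * ?V = four_block_mat (1\<^sub>m n) (0\<^sub>m n k) (0\<^sub>m k n) (v * u + D)"
      using u v D m2 m3 m4 by (simp add: mult_four_block_mat[of _ n n _ k _ k _ _ n _ k])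
    also have "\<dots> = 1\<^sub>m n \<oplus>\<^sub>d (D + v * u)"
      using u v D by (simp add: dsum_def comm_add_mat[of _ k k])
    finally show ?thesis .
  qed
  ultimately show ?thesis
    using u v D by (intro reducesI) auto
qed

section \<open>Peeling off the top factor of a Fiedler product\<close>

lemma mat_prod_simps [simp]:
  "mat_prod N [] = 1\<^sub>m N" "mat_prod N (M # Ms) = M * mat_prod N Ms"
  by (simp_all add: mat_prod_def)

lemma mat_prod_carrier [simp]: "set Ms \<subseteq> carrier_mat N N \<Longrightarrow> mat_prod N Ms \<in> carrier_mat N N"
  by (induction Ms) auto

lemma mat_prod_append:
  "set Ms \<subseteq> carrier_mat N N \<Longrightarrow> set Ks \<subseteq> carrier_mat N N \<Longrightarrow>
    mat_prod N (Ms @ Ks) = mat_prod N Ms * mat_prod N Ks"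
  by (induction Ms)
    (simp_all add: assoc_mult_mat[of _ N N _ N _ N] left_mult_one_mat[OF mat_prod_carrier])

text \<open>With \<open>X i = - A i\<close> this is \<open>M\<^sub>r\<^sup>P\<close> for a tuple \<open>r\<close> from \<open>{0:m-1}\<close>. Plain natural numbers as
  indices spare the case distinction on signs.\<close>

definition pos_prod :: "nat \<Rightarrow> nat \<Rightarrow> (nat \<Rightarrow> complex mat) \<Rightarrow> nat list \<Rightarrow> complex mat" where
  "pos_prod m n X r = mat_prod (m * n) (map (\<lambda>i. elem_mat m n (Pos i) (X i)) r)"

lemma pos_prod_simps [simp]:
  "pos_prod m n X [] = 1\<^sub>m (m * n)"
  "pos_prod m n X (i # r) = elem_mat m n (Pos i) (X i) * pos_prod m n X r"
  by (simp_all add: pos_prod_def)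

lemma pos_prod_carrier:
  assumes "\<And>i. i < m \<Longrightarrow> X i \<in> carrier_mat n n" "set r \<subseteq> {0..<m}"
  shows "pos_prod m n X r \<in> carrier_mat (m * n) (m * n)"
  using assms unfolding pos_prod_def by (intro mat_prod_carrier) (auto intro!: elem_mat_carrier)

lemma pos_prod_append:
  assumes "\<And>i. i < m \<Longrightarrow> X i \<in> carrier_mat n n" "set r \<subseteq> {0..<m}" "set s \<subseteq> {0..<m}"
  shows "pos_prod m n X (r @ s) = pos_prod m n X r * pos_prod m n X s"
  using assms unfolding pos_prod_def
  by (subst map_append, subst mat_prod_append) (auto intro!: elem_mat_carrier)

lemma pos_prod_Suc:
  assumes "\<And>i. i < m \<Longrightarrow> X i \<in> carrier_mat n n" "set r \<subseteq> {0..<m}"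
  shows "pos_prod (Suc m) n X r = 1\<^sub>m n \<oplus>\<^sub>d pos_prod m n X r"
  using assms(2)
proof (induction r)
  case Nil
  then show ?case by (simp add: dsum_one)
next
  case (Cons i r)
  then have "i < m" "set r \<subseteq> {0..<m}" by auto
  then show ?case
    using Cons.IH assms(1) pos_prod_carrier[of m X n r] elem_mat_carrier(1)[of "X i" n i m]
    by (simp add: elem_mat_Suc dsum_mult[of _ n _ _ "m * n"])
qed

lemma pos_prod_commute_top:
  assumes X: "\<And>i. i \<le> m \<Longrightarrow> X i \<in> carrier_mat n n" and r: "set r \<subseteq> {0..<m - 1}"
  shows "elem_mat (Suc m) n (Pos m) (X m) * pos_prod (Suc m) n X r
    = pos_prod (Suc m) n X r * elem_mat (Suc m) n (Pos m) (X m)"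
  using r
proof (induction r)
  case Nil
  show ?case using elem_mat_carrier(1)[OF X[of m], of m "Suc m"] by simp
next
  case (Cons i r)
  let ?N = "Suc m * n" and ?T = "elem_mat (Suc m) n (Pos m) (X m)"
    and ?E = "elem_mat (Suc m) n (Pos i) (X i)" and ?R = "pos_prod (Suc m) n X r"
  have i: "Suc i < m" "set r \<subseteq> {0..<m - 1}" using Cons.prems by auto
  have T: "?T \<in> carrier_mat ?N ?N" by (rule elem_mat_carrier(1)[OF X]) auto
  have E: "?E \<in> carrier_mat ?N ?N" by (rule elem_mat_carrier(1)[OF X]) (use i in auto)
  have R: "?R \<in> carrier_mat ?N ?N" by (rule pos_prod_carrier[OF X]) (use i in auto)
  have "?T * (?E * ?R) = (?T * ?E) * ?R"
    using T E R by (simp only: assoc_mult_mat)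
  also have "\<dots> = ?E * ?T * ?R"
    using elem_mat_commute[OF X X i(1), of m i] i by simp
  also have "\<dots> = ?E * (?T * ?R)"
    using T E R by (simp only: assoc_mult_mat)
  also have "\<dots> = ?E * (?R * ?T)"
    using Cons.IH i by simp
  also have "\<dots> = ?E * ?R * ?T"
    using T E R by (simp only: assoc_mult_mat)
  finally show ?case by simp
qed

text \<open>Among the factors, \<open>M\<^sub>m\<close> fails to commute only with \<open>M\<^sub>m\<^sub>-\<^sub>1\<close>. Since \<open>m - 1\<close> occurs only once, one of the
  two sides of \<open>m\<close> in the tuple avoids it, and \<open>M\<^sub>m\<close> can leave the product through that side.\<close>

lemma pos_prod_peel_top:
  assumes X: "\<And>i. i \<le> m \<Longrightarrow> X i \<in> carrier_mat n n"
    and r: "distinct r" "set r = {0..<Suc m}"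
  obtains s where "distinct s" "set s = {0..<m}"
    "pos_prod (Suc m) n X r = elem_mat (Suc m) n (Pos m) (X m) * (1\<^sub>m n \<oplus>\<^sub>d pos_prod m n X s) \<or>
     pos_prod (Suc m) n X r = (1\<^sub>m n \<oplus>\<^sub>d pos_prod m n X s) * elem_mat (Suc m) n (Pos m) (X m)"
proof -
  let ?N = "Suc m * n" and ?T = "elem_mat (Suc m) n (Pos m) (X m)" and ?F = "pos_prod (Suc m) n X"
  have "m \<in> set r" using r by simp
  then obtain a b where ab: "r = a @ m # b" by (auto simp: in_set_conv_decomp)
  have d: "distinct (a @ b)" "m \<notin> set (a @ b)" using r ab by auto
  have s: "set (a @ b) = {0..<m}"
  proof -
    have "insert m (set (a @ b)) = insert m {0..<m}" using r ab by auto
    then show ?thesis using d(2) by (metis atLeastLessThan_iff insert_ident less_irrefl)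
  qed
  have T: "?T \<in> carrier_mat ?N ?N" by (rule elem_mat_carrier(1)[OF X]) auto
  have Xs: "i < Suc m \<Longrightarrow> X i \<in> carrier_mat n n" for i using X by simp
  have sub: "set a \<subseteq> {0..<Suc m}" "set b \<subseteq> {0..<Suc m}" "set (m # b) \<subseteq> {0..<Suc m}"
    using r ab by auto
  have a: "?F a \<in> carrier_mat ?N ?N" and b: "?F b \<in> carrier_mat ?N ?N"
    using pos_prod_carrier[OF Xs, of "Suc m"] sub by auto
  have r_eq: "?F r = ?F a * (?T * ?F b)"
    using pos_prod_append[OF Xs sub(1,3)] ab by simp
  have ab_eq: "?F (a @ b) = 1\<^sub>m n \<oplus>\<^sub>d pos_prod m n X (a @ b)"
    by (rule pos_prod_Suc) (use X s in auto)
  have ab_app: "?F (a @ b) = ?F a * ?F b"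
    using pos_prod_append[OF Xs sub(1,2)] .
  have "m - 1 \<notin> set a \<or> m - 1 \<notin> set b"
    using d(1) by auto
  then show thesis
  proof
    assume *: "m - 1 \<notin> set a"
    have sub': "set a \<subseteq> {0..<m - 1}"
    proof
      fix i assume "i \<in> set a"
      then have "i < m" "i \<noteq> m - 1" using s * by auto
      then show "i \<in> {0..<m - 1}" by auto
    qed
    have "?T * ?F a = ?F a * ?T" by (rule pos_prod_commute_top[OF X sub'])
    then have "?F r = ?T * ?F (a @ b)"
      unfolding r_eq ab_app by (simp only: assoc_mult_mat[OF a T b, symmetric] assoc_mult_mat[OF T a b, symmetric])
    then show thesis using that[OF d(1) s] ab_eq by simp
  next
    assume *: "m - 1 \<notin> set b"
    have sub': "set b \<subseteq> {0..<m - 1}"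
    proof
      fix i assume "i \<in> set b"
      then have "i < m" "i \<noteq> m - 1" using s * by auto
      then show "i \<in> {0..<m - 1}" by auto
    qed
    have "?T * ?F b = ?F b * ?T" by (rule pos_prod_commute_top[OF X sub'])
    then have "?F r = ?F (a @ b) * ?T"
      unfolding r_eq ab_app by (simp only: assoc_mult_mat[OF a b T])
    then show thesis using that[OF d(1) s] ab_eq by simp
  qed
qed

section \<open>Fiedler pencils by Horner elimination\<close>

text \<open>A single nonzero block at the start of a block row or of a block column: the off-diagonal blocks
  of a Fiedler pencil whose top factor has been cancelled. They are four-block matrices with empty
  blocks, so that their products follow the rule for block multiplication.\<close>

definition top_row :: "nat \<Rightarrow> nat \<Rightarrow> 'a::zero mat \<Rightarrow> 'a mat" where
  "top_row n k R = four_block_mat R (0\<^sub>m n k) (0\<^sub>m 0 n) (0\<^sub>m 0 k)"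

definition left_col :: "nat \<Rightarrow> nat \<Rightarrow> 'a::zero mat \<Rightarrow> 'a mat" where
  "left_col n k S = four_block_mat S (0\<^sub>m n 0) (0\<^sub>m k n) (0\<^sub>m k 0)"

lemma border_carrier [simp]:
  "R \<in> carrier_mat n n \<Longrightarrow> top_row n k R \<in> carrier_mat n (n + k)"
  "R \<in> carrier_mat n n \<Longrightarrow> left_col n k R \<in> carrier_mat (n + k) n"
  by (auto simp: top_row_def left_col_def)

lemma border_mult:
  fixes S R :: "'a::semiring_1 mat"
  assumes "S \<in> carrier_mat n n" "R \<in> carrier_mat n n"
  shows "left_col n k S * top_row n k R = S * R \<oplus>\<^sub>d 0\<^sub>m k k"
  using assms
  by (simp add: left_col_def top_row_def dsum_def
      mult_four_block_mat[of _ n n _ 0 _ k _ _ n _ k])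

lemma elem_mat_top_inverse:
  assumes "X \<in> carrier_mat n n"
  shows "elem_mat (Suc (Suc k)) n (Neg (Suc k)) X
    = four_block_mat (0\<^sub>m n n) (top_row n (k * n) (1\<^sub>m n)) (left_col n (k * n) (1\<^sub>m n)) (X \<oplus>\<^sub>d 1\<^sub>m (k * n))"
  using assms unfolding elem_mat_Neg swap_block_inv_def dsum_def top_row_def left_col_def
  by (intro eq_matI) auto

text \<open>The Horner step in matrix form. The off-diagonal blocks contribute \<open>x\<^sup>2 (S * R)\<close> to the Schur
  complement, which turns the coefficient \<open>C\<close> into \<open>C + x (S * R)\<close>. The product \<open>S * R\<close> will be the
  old leading coefficient, with \<open>R = I\<close> or \<open>S = I\<close> according to the side on which the top factor
  was cancelled.\<close>

lemma schur_pencil_reduces: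
  fixes S R C N :: "complex poly mat"
  assumes "S \<in> carrier_mat n n" "R \<in> carrier_mat n n" "C \<in> carrier_mat n n"
    and N: "N \<in> carrier_mat (n + k) (n + k)"
  shows "reduces (n + (n + k))
    (x \<cdot>\<^sub>m four_block_mat (0\<^sub>m n n) (top_row n k R) (left_col n k S) (C \<oplus>\<^sub>d 1\<^sub>m k) - (1\<^sub>m n \<oplus>\<^sub>d N))
    (1\<^sub>m n \<oplus>\<^sub>d (x \<cdot>\<^sub>m ((C + x \<cdot>\<^sub>m (S * R)) \<oplus>\<^sub>d 1\<^sub>m k) - N))"
proof -
  let ?u = "x \<cdot>\<^sub>m top_row n k R" and ?v = "x \<cdot>\<^sub>m left_col n k S"
    and ?D = "x \<cdot>\<^sub>m (C \<oplus>\<^sub>d 1\<^sub>m k) - N"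
  have c: "?u \<in> carrier_mat n (n + k)" "?v \<in> carrier_mat (n + k) n" "?D \<in> carrier_mat (n + k) (n + k)"
    using assms by auto
  have lhs: "x \<cdot>\<^sub>m four_block_mat (0\<^sub>m n n) (top_row n k R) (left_col n k S) (C \<oplus>\<^sub>d 1\<^sub>m k) - (1\<^sub>m n \<oplus>\<^sub>d N)
      = four_block_mat (- 1\<^sub>m n) ?u ?v ?D" (is "?L = ?F")
  proof (rule eq_matI)
    have d: "dim_row (top_row n k R) = n" "dim_col (top_row n k R) = n + k"
      "dim_row (left_col n k S) = n + k" "dim_col (left_col n k S) = n"
      using border_carrier(1)[OF assms(2), of k] border_carrier(2)[OF assms(1), of k] by auto
    fix i j assume "i < dim_row ?F" "j < dim_col ?F"
    then show "?L $$ (i, j) = ?F $$ (i, j)"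
      using assms d by (auto simp: dsum_def[of "1\<^sub>m n" N])
  qed (use assms in auto)
  have "?v * ?u = x \<cdot>\<^sub>m (x \<cdot>\<^sub>m (S * R \<oplus>\<^sub>d 0\<^sub>m k k))"
    using border_carrier(1)[OF assms(2), of k] border_carrier(2)[OF assms(1), of k]
    by (simp add: mult_smult_distrib[of _ "n + k" n _ "n + k"] mult_smult_assoc_mat[of _ "n + k" n _ "n + k"]
       border_mult[OF assms(1,2)])
  then have "?D + ?v * ?u = x \<cdot>\<^sub>m ((C + x \<cdot>\<^sub>m (S * R)) \<oplus>\<^sub>d 1\<^sub>m k) - N"
    using assms by (auto simp: dsum_def algebra_simps intro!: eq_matI)
  then show ?thesis
    using schur_reduces[OF c] lhs by simp
qed

text \<open>The polynomial \<open>\<lambda>\<^sup>m B + (\<lambda>\<^sup>m\<^sup>-\<^sup>1 A\<^sub>m\<^sub>-\<^sub>1 + ... + A\<^sub>0)\<close>, whose coefficient \<open>B\<close> may itself depend on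
  \<open>\<lambda>\<close>: the state of Horner's scheme before the lower coefficients have been absorbed.\<close>

definition poly_with_lead ::
  "nat \<Rightarrow> nat \<Rightarrow> complex poly mat \<Rightarrow> (nat \<Rightarrow> complex mat) \<Rightarrow> complex poly mat" where
  "poly_with_lead n m B A =
    mat n n (\<lambda>(i, j). monom 1 m * B $$ (i, j) + (\<Sum>k<m. monom (A k $$ (i, j)) k))"

lemma poly_with_lead_Suc:
  assumes "A m \<in> carrier_mat n n" "B \<in> carrier_mat n n"
  shows "poly_with_lead n (Suc m) B A = poly_with_lead n m (const_mat (A m) + [:0, 1:] \<cdot>\<^sub>m B) A"
proof -
  have a: "monom 1 m * [:a:] = monom a m" for a :: complex
    by (simp add: monom_altdef)
  have b: "monom 1 (Suc m) = monom 1 m * [:0, 1 :: complex:]"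
    by (simp only: monom_altdef smult_1_left power_Suc2)
  show ?thesis
    using assms unfolding poly_with_lead_def const_mat_def b
    by (intro eq_matI) (simp_all add: distrib_left a mult.assoc del: mult_pCons_right mult_pCons_left)
qed

lemma poly_with_lead_const:
  assumes "A m \<in> carrier_mat n n"
  shows "poly_with_lead n m (const_mat (A m)) A = mat_polynomial n m A"
  using assms unfolding poly_with_lead_def mat_polynomial_def const_mat_def
  by (intro eq_matI) (auto simp: lessThan_Suc_atMost[symmetric] monom_altdef)

lemma reduces_refl: "L \<in> carrier_mat N N \<Longrightarrow> reduces N L L"
  by (rule reducesI[OF unimodular_one unimodular_one]) auto

lemma reduces_const:
  assumes "S \<in> carrier_mat N N" "S' \<in> carrier_mat N N" "S * S' = 1\<^sub>m N"
    and "T \<in> carrier_mat N N" "T' \<in> carrier_mat N N" "T * T' = 1\<^sub>m N" "L \<in> carrier_mat N N"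
  shows "reduces N L (const_mat S * L * const_mat T)"
  using assms by (intro reducesI[of _ "const_mat S" "const_mat T"] unimodular_const) auto

text \<open>The induction generalizes over the leading coefficient \<open>B\<close>, which each elimination step replaces
  by \<open>A\<^sub>k + \<lambda>B\<close>, and over the order \<open>r\<close> of the factors, since deleting the top index leaves an
  arbitrary permutation of the others.\<close>

lemma fiedler_pencil_horner:
  assumes "distinct r" "set r = {0..<Suc k}" "\<And>i. i \<le> k \<Longrightarrow> A i \<in> carrier_mat n n"
    and "B \<in> carrier_mat n n"
  shows "reduces (Suc k * n)
    ([:0, 1:] \<cdot>\<^sub>m (B \<oplus>\<^sub>d 1\<^sub>m (k * n)) - const_mat (pos_prod (Suc k) n (\<lambda>i. - A i) r))
    (1\<^sub>m (k * n) \<oplus>\<^sub>d poly_with_lead n (Suc k) B A)"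
  using assms
proof (induction k arbitrary: r B)
  case 0
  have "r = [0]"
  proof -
    have "length r = Suc 0" using distinct_card[OF 0(1)] 0(2) by simp
    then obtain x where "r = [x]" by (auto simp: length_Suc_conv)
    then show ?thesis using 0(2) by simp
  qed
  then have "[:0, 1:] \<cdot>\<^sub>m (B \<oplus>\<^sub>d 1\<^sub>m (0 * n)) - const_mat (pos_prod (Suc 0) n (\<lambda>i. - A i) r)
      = poly_with_lead n (Suc 0) B A"
    using 0(3)[of 0] 0(4)
    by (auto simp: elem_mat_Pos poly_with_lead_def const_mat_def monom_altdef intro!: eq_matI)
  moreover have "poly_with_lead n (Suc 0) B A \<in> carrier_mat n n" by (simp add: poly_with_lead_def)
  ultimately show ?case by (simp add: reduces_refl)
next
  case (Suc k)
  let ?x = "[:0, 1 :: complex:]" and ?j = "Suc k" and ?X = "\<lambda>i. - A i"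
  let ?n = "Suc ?j * n" and ?T = "elem_mat (Suc ?j) n (Pos ?j) (- A ?j)"
    and ?J = "elem_mat (Suc ?j) n (Neg ?j) (A ?j)"
  have n: "?n = n + (n + k * n)" by simp
  have X: "i \<le> ?j \<Longrightarrow> ?X i \<in> carrier_mat n n" for i using Suc.prems(3) by simp
  obtain s where s: "distinct s" "set s = {0..<?j}"
    and peel: "pos_prod (Suc ?j) n ?X r = ?T * (1\<^sub>m n \<oplus>\<^sub>d pos_prod ?j n ?X s) \<or>
     pos_prod (Suc ?j) n ?X r = (1\<^sub>m n \<oplus>\<^sub>d pos_prod ?j n ?X s) * ?T"
    using pos_prod_peel_top[where X = "?X", OF X Suc.prems(1,2)] by blast
  let ?M = "pos_prod ?j n ?X s" and ?R = "pos_prod (Suc ?j) n ?X r"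
  let ?N = "const_mat ?M" and ?C = "const_mat (A ?j)"
  have A: "A ?j \<in> carrier_mat n n" and B: "B \<in> carrier_mat n n"
    using Suc.prems by auto
  have M: "?M \<in> carrier_mat (n + k * n) (n + k * n)"
    using pos_prod_carrier[of ?j ?X n s] X s by simp
  have R: "?R \<in> carrier_mat ?n ?n"
    by (rule pos_prod_carrier) (use X Suc.prems in auto)
  have T: "?T \<in> carrier_mat ?n ?n" by (rule elem_mat_carrier(1)) (use A in auto)
  have J: "?J \<in> carrier_mat ?n ?n" by (rule elem_mat_carrier(2)) (use A in auto)
  have JT: "?T * ?J = 1\<^sub>m ?n" "?J * ?T = 1\<^sub>m ?n"
    using elem_mat_inverse[of "- A ?j" n ?j "Suc ?j"] A by auto
  have M1: "1\<^sub>m n \<oplus>\<^sub>d ?M \<in> carrier_mat ?n ?n" unfolding n using M by simp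
  let ?G = "B \<oplus>\<^sub>d (1\<^sub>m (?j * n) :: complex poly mat)"
  have G: "?G \<in> carrier_mat ?n ?n" using B unfolding n by simp
  have cJ: "const_mat ?J = four_block_mat (0\<^sub>m n n) (top_row n (k * n) (1\<^sub>m n))
      (left_col n (k * n) (1\<^sub>m n)) (?C \<oplus>\<^sub>d 1\<^sub>m (k * n))"
    using A unfolding elem_mat_top_inverse[OF A] const_mat_def top_row_def left_col_def dsum_def
    by (intro eq_matI) auto
  define H where "H S Q = four_block_mat (0\<^sub>m n n) (top_row n (k * n) Q) (left_col n (k * n) S)
      (?C \<oplus>\<^sub>d 1\<^sub>m (k * n))" for S Q
  have G4: "?G = four_block_mat B (0\<^sub>m n (n + k * n)) (0\<^sub>m (n + k * n) n) (1\<^sub>m (n + k * n))"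
    using B by (simp add: dsum_def)
  have colB: "left_col n (k * n) (1\<^sub>m n) * B = left_col n (k * n) B"
    "B * top_row n (k * n) (1\<^sub>m n) = top_row n (k * n) B"
  proof -
    have b: "B = four_block_mat B (0\<^sub>m n 0) (0\<^sub>m 0 n) (0\<^sub>m 0 0)" using B by (intro eq_matI) auto
    show "left_col n (k * n) (1\<^sub>m n) * B = left_col n (k * n) B"
      apply (subst b)
      unfolding left_col_def using B
      by (simp add: mult_four_block_mat[of _ n n _ 0 _ "k * n" _ _ n _ 0])
    show "B * top_row n (k * n) (1\<^sub>m n) = top_row n (k * n) B"
      apply (subst b)
      unfolding top_row_def using B
      by (simp add: mult_four_block_mat[of _ n n _ 0 _ 0 _ _ n _ "k * n"])
  qed
  have C: "?C \<in> carrier_mat n n" using A by simp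
  have E: "top_row n (k * n) (1\<^sub>m n :: complex poly mat) \<in> carrier_mat n (n + k * n)"
    "left_col n (k * n) (1\<^sub>m n :: complex poly mat) \<in> carrier_mat (n + k * n) n"
    "?C \<oplus>\<^sub>d 1\<^sub>m (k * n) \<in> carrier_mat (n + k * n) (n + k * n)"
    "left_col n (k * n) B \<in> carrier_mat (n + k * n) n"
    "top_row n (k * n) B \<in> carrier_mat n (n + k * n)"
    using C B by simp_all
  note units = E[THEN right_mult_zero_mat] E[THEN right_mult_one_mat] E[THEN left_mult_zero_mat]
    E[THEN left_mult_one_mat] E[THEN right_add_zero_mat] E[THEN left_add_zero_mat]
  \<comment> \<open>Both sides of cancellation produce this form: \<open>S = B, Q = I\<close> on the left, \<open>S = I, Q = B\<close> on the right.\<close>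
  have reduced: "reduces ?n (?x \<cdot>\<^sub>m H S Q - const_mat (1\<^sub>m n \<oplus>\<^sub>d ?M)) (1\<^sub>m (?j * n) \<oplus>\<^sub>d poly_with_lead n (Suc ?j) B A)"
    if SQ: "S \<in> carrier_mat n n" "Q \<in> carrier_mat n n" "S * Q = B" for S Q
  proof -
    have "reduces ?n (?x \<cdot>\<^sub>m H S Q - (1\<^sub>m n \<oplus>\<^sub>d ?N))
      (1\<^sub>m n \<oplus>\<^sub>d (?x \<cdot>\<^sub>m ((?C + ?x \<cdot>\<^sub>m B) \<oplus>\<^sub>d 1\<^sub>m (k * n)) - ?N))"
      using schur_pencil_reduces[OF SQ(1,2) C, of ?N "k * n" ?x] M SQ(3) by (simp add: H_def n)
    moreover have "reduces (n + ?j * n)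
      (1\<^sub>m n \<oplus>\<^sub>d (?x \<cdot>\<^sub>m ((?C + ?x \<cdot>\<^sub>m B) \<oplus>\<^sub>d 1\<^sub>m (k * n)) - ?N))
      (1\<^sub>m n \<oplus>\<^sub>d 1\<^sub>m (k * n) \<oplus>\<^sub>d poly_with_lead n ?j (?C + ?x \<cdot>\<^sub>m B) A)"
      by (rule reduces_dsum, rule Suc.IH[OF s]) (use Suc.prems C in auto)
    moreover have "1\<^sub>m n \<oplus>\<^sub>d 1\<^sub>m (k * n) \<oplus>\<^sub>d poly_with_lead n ?j (?C + ?x \<cdot>\<^sub>m B) A
       = 1\<^sub>m (?j * n) \<oplus>\<^sub>d poly_with_lead n (Suc ?j) B A"
      using A B by (simp add: poly_with_lead_Suc dsum_assoc[symmetric] dsum_one)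
    ultimately show ?thesis
      by (simp add: const_mat_dsum reduces_trans)
  qed
  let ?L = "?x \<cdot>\<^sub>m ?G - const_mat ?R"
  have L: "?L \<in> carrier_mat ?n ?n" by (intro minus_carrier_mat const_mat_carrier R)
  have cR: "const_mat ?R \<in> carrier_mat ?n ?n" and cJm: "const_mat ?J \<in> carrier_mat ?n ?n"
    and xG: "?x \<cdot>\<^sub>m ?G \<in> carrier_mat ?n ?n"
    by (rule const_mat_carrier[OF R], rule const_mat_carrier[OF J], rule smult_carrier_mat[OF G])
  from peel show ?case
  proof
    assume left: "?R = ?T * (1\<^sub>m n \<oplus>\<^sub>d ?M)"
    have "?J * ?R = 1\<^sub>m n \<oplus>\<^sub>d ?M"
      unfolding left
      by (simp only: assoc_mult_mat[OF J T M1, symmetric] JT left_mult_one_mat[OF M1])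
    then have 1: "const_mat ?J * const_mat ?R = const_mat (1\<^sub>m n \<oplus>\<^sub>d ?M)"
      by (simp only: const_mat_mult[OF J R, symmetric] const_mat_mult[OF R J, symmetric])
    have 2: "const_mat ?J * ?G = H B (1\<^sub>m n)"
      unfolding cJ G4 H_def using B colB E
      by (simp add: units mult_four_block_mat[of _ n n _ "n + k * n" _ "n + k * n" _ _ n _ "n + k * n"])
    have 3: "const_mat ?J * ?L * const_mat (1\<^sub>m ?n) = ?x \<cdot>\<^sub>m H B (1\<^sub>m n) - const_mat (1\<^sub>m n \<oplus>\<^sub>d ?M)"
    proof -
      have "const_mat ?J * ?L = const_mat ?J * (?x \<cdot>\<^sub>m ?G) - const_mat ?J * const_mat ?R"
        by (rule mult_minus_distrib_mat[OF cJm xG cR])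
      also have "const_mat ?J * (?x \<cdot>\<^sub>m ?G) = ?x \<cdot>\<^sub>m (const_mat ?J * ?G)"
        by (rule mult_smult_distrib[OF cJm G])
      finally have "const_mat ?J * ?L = ?x \<cdot>\<^sub>m H B (1\<^sub>m n) - const_mat (1\<^sub>m n \<oplus>\<^sub>d ?M)"
        by (simp only: 1 2)
      moreover have "const_mat ?J * ?L \<in> carrier_mat ?n ?n"
        using J L by (metis const_mat_carrier mult_carrier_mat)
      ultimately show ?thesis by (simp only: const_mat_one right_mult_one_mat)
    qed
    have "reduces ?n ?L (const_mat ?J * ?L * const_mat (1\<^sub>m ?n))"
      by (rule reduces_const[OF J T JT(2) one_carrier_mat one_carrier_mat _ L]) simp
    then show ?thesis
      unfolding 3 by (rule reduces_trans) (rule reduced, use B in auto)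
  next
    assume right: "?R = (1\<^sub>m n \<oplus>\<^sub>d ?M) * ?T"
    have "?R * ?J = 1\<^sub>m n \<oplus>\<^sub>d ?M"
      unfolding right
      by (simp only: assoc_mult_mat[OF M1 T J] JT right_mult_one_mat[OF M1])
    then have 1: "const_mat ?R * const_mat ?J = const_mat (1\<^sub>m n \<oplus>\<^sub>d ?M)"
      by (simp only: const_mat_mult[OF J R, symmetric] const_mat_mult[OF R J, symmetric])
    have 2: "?G * const_mat ?J = H (1\<^sub>m n) B"
      unfolding cJ G4 H_def using B colB E
      by (simp add: units mult_four_block_mat[of _ n n _ "n + k * n" _ "n + k * n" _ _ n _ "n + k * n"])
    have 3: "const_mat (1\<^sub>m ?n) * ?L * const_mat ?J = ?x \<cdot>\<^sub>m H (1\<^sub>m n) B - const_mat (1\<^sub>m n \<oplus>\<^sub>d ?M)"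
    proof -
      have "?L * const_mat ?J = (?x \<cdot>\<^sub>m ?G) * const_mat ?J - const_mat ?R * const_mat ?J"
        by (rule minus_mult_distrib_mat[OF xG cR cJm])
      also have "(?x \<cdot>\<^sub>m ?G) * const_mat ?J = ?x \<cdot>\<^sub>m (?G * const_mat ?J)"
        by (rule mult_smult_assoc_mat[OF G cJm])
      finally have "?L * const_mat ?J = ?x \<cdot>\<^sub>m H (1\<^sub>m n) B - const_mat (1\<^sub>m n \<oplus>\<^sub>d ?M)"
        by (simp only: 1 2)
      moreover have "1\<^sub>m ?n * ?L = ?L" using L by (rule left_mult_one_mat)
      ultimately show ?thesis by (simp only: const_mat_one)
    qed
    have "reduces ?n ?L (const_mat (1\<^sub>m ?n) * ?L * const_mat ?J)"
      by (rule reduces_const[OF one_carrier_mat one_carrier_mat _ J T JT(2) L]) simp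
    then show ?thesis
      unfolding 3 by (rule reduces_trans) (rule reduced, use B in auto)
  qed
qed

section \<open>Invertible factors and strict equivalence\<close>

definition inv_pair :: "nat \<Rightarrow> complex mat \<Rightarrow> complex mat \<Rightarrow> bool" where
  "inv_pair N S S' \<longleftrightarrow> S \<in> carrier_mat N N \<and> S' \<in> carrier_mat N N \<and> S * S' = 1\<^sub>m N \<and> S' * S = 1\<^sub>m N"

lemma inv_pair_sym: "inv_pair N S S' \<Longrightarrow> inv_pair N S' S"
  by (auto simp: inv_pair_def)

lemma inv_pair_carrier:
  "inv_pair N S S' \<Longrightarrow> S \<in> carrier_mat N N" "inv_pair N S S' \<Longrightarrow> S' \<in> carrier_mat N N"
  by (auto simp: inv_pair_def)

lemma inv_pair_cancel:
  assumes "inv_pair N S S'" "Z \<in> carrier_mat N N"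
  shows "S * (S' * Z) = Z" "S' * (S * Z) = Z"
proof -
  have c: "S \<in> carrier_mat N N" "S' \<in> carrier_mat N N" "S * S' = 1\<^sub>m N" "S' * S = 1\<^sub>m N"
    using assms by (auto simp: inv_pair_def)
  have "S * (S' * Z) = S * S' * Z" "S' * (S * Z) = S' * S * Z"
    using assoc_mult_mat[OF c(1,2) assms(2)] assoc_mult_mat[OF c(2,1) assms(2)] by simp_all
  then show "S * (S' * Z) = Z" "S' * (S * Z) = Z"
    using c assms(2) by simp_all
qed

lemma inv_pair_one: "inv_pair N (1\<^sub>m N) (1\<^sub>m N)"
  by (simp add: inv_pair_def)

lemma inv_pair_mult:
  assumes "inv_pair N S S'" "inv_pair N T T'"
  shows "inv_pair N (S * T) (T' * S')"
proof -
  have c: "S \<in> carrier_mat N N" "S' \<in> carrier_mat N N" "T \<in> carrier_mat N N" "T' \<in> carrier_mat N N"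
    and 1: "S * S' = 1\<^sub>m N" "T' * T = 1\<^sub>m N"
    using assms by (auto simp: inv_pair_def)
  have "S * T * (T' * S') = S * (T * (T' * S'))" "T' * S' * (S * T) = T' * (S' * (S * T))"
    using c by (simp_all add: assoc_mult_mat[of _ N N _ N _ N])
  then show ?thesis
    using c 1 inv_pair_cancel(1)[OF assms(2) c(2)] inv_pair_cancel(2)[OF assms(1) c(3)]
    by (simp add: inv_pair_def)
qed

lemma inv_pair_mat_prod:
  assumes "\<And>i. i \<in> set t \<Longrightarrow> inv_pair N (f i) (g i)"
  shows "inv_pair N (mat_prod N (map f t)) (mat_prod N (map g (rev t)))"
  using assms
proof (induction t)
  case Nil
  then show ?case by (simp add: inv_pair_one)
next
  case (Cons i t)
  have g: "set (map g (rev t)) \<subseteq> carrier_mat N N" "g i \<in> carrier_mat N N"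
    using Cons.prems by (auto dest: inv_pair_carrier)
  then have "mat_prod N (map g (rev (i # t))) = mat_prod N (map g (rev t)) * g i"
    by (simp add: mat_prod_append)
  then show ?case
    using inv_pair_mult[OF Cons.prems[of i] Cons.IH] Cons.prems by simp
qed

lemma invertible_mat_inv_pair:
  assumes "invertible_mat X" "X \<in> carrier_mat n n"
  obtains Y where "inv_pair n X Y"
proof -
  obtain Y where Y: "X * Y = 1\<^sub>m n" "Y * X = 1\<^sub>m (dim_row Y)"
    using assms by (auto simp: invertible_mat_def inverts_mat_def)
  have "dim_col (X * Y) = n" using Y(1) by simp
  moreover have "dim_col (Y * X) = dim_row Y" using Y(2) by simp
  ultimately have "Y \<in> carrier_mat n n" using assms(2) by auto
  then show thesis using that[of Y] Y assms(2) by (simp add: inv_pair_def)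
qed

lemma inv_pair_mat_inverse:
  assumes "inv_pair N S S'"
  shows "inv_pair N S (the (mat_inverse S))"
proof -
  have S: "S \<in> carrier_mat N N" using assms by (rule inv_pair_carrier)
  have "S \<in> Units (ring_mat TYPE(complex) N ())"
    using assms by (auto simp: inv_pair_def Units_def ring_mat_def)
  then obtain B where "mat_inverse S = Some B"
    using mat_inverse(1)[OF S, of "()"] by blast
  then show ?thesis
    using mat_inverse(2)[OF S] S by (auto simp: inv_pair_def)
qed

lemma elem_mat_inv_pair:
  assumes "X \<in> carrier_mat n n" "1 \<le> k" "k < m"
  shows "inv_pair (m * n) (elem_mat m n (Pos k) X) (elem_mat m n (Neg k) (- X))"
    and "inv_pair (m * n) (elem_mat m n (Neg k) X) (elem_mat m n (Pos k) (- X))"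
proof -
  have *: "inv_pair (m * n) (elem_mat m n (Pos k) Z) (elem_mat m n (Neg k) (- Z))"
    if "Z \<in> carrier_mat n n" for Z
    using elem_mat_inverse[OF that assms(2,3)] elem_mat_carrier[OF that] elem_mat_carrier[of "- Z" n] that assms
    by (simp add: inv_pair_def)
  then show "inv_pair (m * n) (elem_mat m n (Pos k) X) (elem_mat m n (Neg k) (- X))"
    using assms(1) .
  show "inv_pair (m * n) (elem_mat m n (Neg k) X) (elem_mat m n (Pos k) (- X))"
    using inv_pair_sym[OF *[of "- X"]] assms by simp
qed

lemma elem_mat_end_inv_pair:
  assumes "inv_pair n X Y" "1 \<le> m"
  shows "inv_pair (m * n) (elem_mat m n (Pos 0) X) (elem_mat m n (Pos 0) Y)"
    and "inv_pair (m * n) (elem_mat m n (Neg m) X) (elem_mat m n (Neg m) Y)"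
proof -
  have c: "X \<in> carrier_mat n n" "Y \<in> carrier_mat n n" "X * Y = 1\<^sub>m n" "Y * X = 1\<^sub>m n"
    using assms by (auto simp: inv_pair_def)
  show "inv_pair (m * n) (elem_mat m n (Pos 0) X) (elem_mat m n (Pos 0) Y)"
    "inv_pair (m * n) (elem_mat m n (Neg m) X) (elem_mat m n (Neg m) Y)"
    using elem_mat_end_inverse[OF c(1,2,3) assms(2)] elem_mat_end_inverse[OF c(2,1,4) assms(2)]
      elem_mat_carrier[OF c(1), of _ m] elem_mat_carrier[OF c(2), of _ m] assms(2)
    by (simp_all add: inv_pair_def)
qed

lemma inv_pair_uminus: "inv_pair N X Y \<Longrightarrow> inv_pair N (- X) (- Y)"
  by (auto simp: inv_pair_def)

text \<open>The index range leaves out \<open>m\<close> and \<open>-0\<close>, whose elementary matrices do not take an argument.\<close>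

lemma elem_prod_invertible:
  assumes m: "1 \<le> m"
    and t: "set t \<subseteq> Pos ` {0..<m} \<union> Neg ` {1..m}"
    and X: "matrix_assignment n t X" "nonsingular_assignment m t X"
  obtains S where "inv_pair (m * n) (elem_prod m n t X) S"
proof -
  have elem: "\<exists>S. inv_pair (m * n) (elem_mat m n (t ! k) (X ! k)) S" if k: "k < length t" for k
  proof -
    have Xk: "X ! k \<in> carrier_mat n n"
      using X(1) k by (auto simp: matrix_assignment_def)
    have ends: "\<exists>Y. inv_pair n (X ! k) Y" if "t ! k \<in> {Pos 0, Neg m}"
      using X(2) k that invertible_mat_inv_pair[OF _ Xk]
      by (metis insertCI insertE nonsingular_assignment_def singletonD)
    have "t ! k \<in> Pos ` {0..<m} \<union> Neg ` {1..m}" using t k nth_mem by blast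
    then consider "t ! k = Pos 0" | "t ! k = Neg m"
      | i where "t ! k = Pos i" "1 \<le> i" "i < m" | i where "t ! k = Neg i" "1 \<le> i" "i < m"
      by force
    then show ?thesis
    proof cases
      case 1
      then show ?thesis using ends elem_mat_end_inv_pair(1)[OF _ m] by auto
    next
      case 2
      then show ?thesis using ends elem_mat_end_inv_pair(2)[OF _ m] by auto
    next
      case 3
      then show ?thesis using elem_mat_inv_pair(1)[OF Xk] by auto
    next
      case 4
      then show ?thesis using elem_mat_inv_pair(2)[OF Xk] by auto
    qed
  qed
  have "\<exists>S. inv_pair (m * n) M S" if "M \<in> set (map2 (elem_mat m n) t X)" for M
    using that elem by (auto simp: set_zip)
  then obtain g where "\<And>M. M \<in> set (map2 (elem_mat m n) t X) \<Longrightarrow> inv_pair (m * n) M (g M)"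
    by metis
  then have "inv_pair (m * n) (mat_prod (m * n) (map (\<lambda>M. M) (map2 (elem_mat m n) t X)))
      (mat_prod (m * n) (map g (rev (map2 (elem_mat m n) t X))))"
    by (intro inv_pair_mat_prod)
  then show thesis using that unfolding elem_prod_def list.map_ident by blast
qed

text \<open>The pencils with coefficient pairs \<open>(X, Y)\<close> and \<open>(X', Y')\<close> differ by invertible constant factors.
  Speaking of the pairs, not of the pencils, makes one statement serve a pencil and its reversal.\<close>

definition strictly_equivalent ::
  "nat \<Rightarrow> complex mat \<Rightarrow> complex mat \<Rightarrow> complex mat \<Rightarrow> complex mat \<Rightarrow> bool" where
  "strictly_equivalent N X Y X' Y' \<longleftrightarrow> X \<in> carrier_mat N N \<and> Y \<in> carrier_mat N N \<and>
    (\<exists>S S' T T'. inv_pair N S S' \<and> inv_pair N T T' \<and> X' = S * X * T \<and> Y' = S * Y * T)"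

lemma strictly_equivalentI:
  assumes "inv_pair N S S'" "inv_pair N T T'" "X \<in> carrier_mat N N" "Y \<in> carrier_mat N N"
    "X' = S * X * T" "Y' = S * Y * T"
  shows "strictly_equivalent N X Y X' Y'"
  using assms unfolding strictly_equivalent_def by blast

lemma strictly_equivalent_sym:
  assumes "strictly_equivalent N X Y X' Y'"
  shows "strictly_equivalent N X' Y' X Y"
proof -
  obtain S S' T T' where *: "inv_pair N S S'" "inv_pair N T T'" "X' = S * X * T" "Y' = S * Y * T"
    and XY: "X \<in> carrier_mat N N" "Y \<in> carrier_mat N N"
    using assms by (auto simp: strictly_equivalent_def)
  have c: "S \<in> carrier_mat N N" "S' \<in> carrier_mat N N" "T \<in> carrier_mat N N" "T' \<in> carrier_mat N N"
    "T * T' = 1\<^sub>m N"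
    using * by (auto simp: inv_pair_def)
  have "S' * (S * Z * T) * T' = Z" if "Z \<in> carrier_mat N N" for Z
  proof -
    have "S' * (S * Z * T) * T' = S' * (S * (Z * (T * T')))"
      using c that by (simp add: assoc_mult_mat[of _ N N _ N _ N])
    also have "\<dots> = Z" using c(5) that inv_pair_cancel(2)[OF *(1)] by simp
    finally show ?thesis .
  qed
  then show ?thesis
    using inv_pair_sym[OF *(1)] inv_pair_sym[OF *(2)] XY c *
    by (intro strictly_equivalentI[of N S' S T' T]) auto
qed

lemma strictly_equivalent_trans:
  assumes "strictly_equivalent N X Y X' Y'" "strictly_equivalent N X' Y' X'' Y''"
  shows "strictly_equivalent N X Y X'' Y''"
proof -
  obtain S S' T T' where 1: "inv_pair N S S'" "inv_pair N T T'" "X' = S * X * T" "Y' = S * Y * T"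
    and XY: "X \<in> carrier_mat N N" "Y \<in> carrier_mat N N"
    using assms(1) by (auto simp: strictly_equivalent_def)
  obtain R R' Q Q' where 2: "inv_pair N R R'" "inv_pair N Q Q'" "X'' = R * X' * Q" "Y'' = R * Y' * Q"
    using assms(2) by (auto simp: strictly_equivalent_def)
  have c: "S \<in> carrier_mat N N" "R \<in> carrier_mat N N" "T \<in> carrier_mat N N" "Q \<in> carrier_mat N N"
    using 1 2 by (auto simp: inv_pair_def)
  have "R * (S * Z * T) * Q = (R * S) * Z * (T * Q)" if "Z \<in> carrier_mat N N" for Z
    using c that by (simp add: assoc_mult_mat[of _ N N _ N _ N])
  then show ?thesis
    using XY 1 2
    by (intro strictly_equivalentI[OF inv_pair_mult[OF 2(1) 1(1)] inv_pair_mult[OF 1(2) 2(2)]]) auto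
qed

lemma strictly_equivalent_reduces:
  assumes "strictly_equivalent N X Y X' Y'"
  shows "reduces N (pencil (- X) Y) (pencil (- X') Y')"
    and "reduces N (pencil Y (- X)) (pencil Y' (- X'))"
proof -
  obtain S S' T T' where *: "inv_pair N S S'" "inv_pair N T T'" "X' = S * X * T" "Y' = S * Y * T"
    and XY: "X \<in> carrier_mat N N" "Y \<in> carrier_mat N N"
    using assms by (auto simp: strictly_equivalent_def)
  have c: "S \<in> carrier_mat N N" "S' \<in> carrier_mat N N" "T \<in> carrier_mat N N" "T' \<in> carrier_mat N N"
    "S * S' = 1\<^sub>m N" "T * T' = 1\<^sub>m N"
    using * by (auto simp: inv_pair_def)
  have m: "- X' = S * (- X) * T"
    using c(1,3) XY(1) *(3) by auto
  have mX: "- X \<in> carrier_mat N N" using XY by simp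
  note rc = reduces_const[OF c(1,2,5) c(3,4,6)]
  show "reduces N (pencil (- X) Y) (pencil (- X') Y')"
    using rc[OF pencil_carrier[OF mX XY(2)]] pencil_mult[OF c(1,3) mX XY(2)] m *(4) by simp
  show "reduces N (pencil Y (- X)) (pencil Y' (- X'))"
    using rc[OF pencil_carrier[OF XY(2) mX]] pencil_mult[OF c(1,3) XY(2) mX] m *(4) by simp
qed

section \<open>From a generalized Fiedler pencil to a Fiedler pencil\<close>

text \<open>The two indices at the ends are the only ones that need a hypothesis: \<open>M\<^sub>0\<^sup>P\<close> and \<open>M\<^sub>-\<^sub>m\<^sup>P\<close> are
  invertible exactly when \<open>A\<^sub>0\<close> and \<open>A\<^sub>m\<close> are.\<close>

lemma fiedler_mat_inv_pair:
  assumes "1 \<le> m" "\<And>i. i \<le> m \<Longrightarrow> A i \<in> carrier_mat n n" "k \<le> m"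
    and A0: "k = 0 \<Longrightarrow> invertible_mat (A 0)" and Am: "k = m \<Longrightarrow> invertible_mat (A m)"
  shows "inv_pair (m * n) (fiedler_mat m n A (Pos k)) (fiedler_mat m n A (Neg k))"
proof -
  have A: "A k \<in> carrier_mat n n" using assms by simp
  consider "k = 0" | "k = m" "k \<noteq> 0" | "1 \<le> k" "k < m" using assms(3) by linarith
  then show ?thesis
  proof cases
    case 1
    obtain Y where "inv_pair n (A 0) Y"
      using A0[OF 1] A 1 by (auto elim: invertible_mat_inv_pair)
    then have "inv_pair (m * n) (elem_mat m n (Pos 0) (- A 0)) (elem_mat m n (Pos 0) (- Y))"
      by (intro elem_mat_end_inv_pair(1) inv_pair_uminus assms(1))
    then show ?thesis
      using inv_pair_mat_inverse 1 assms(1) by simp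
  next
    case 2
    obtain Y where "inv_pair n (A m) Y"
      using Am[OF 2(1)] A 2 by (auto elim: invertible_mat_inv_pair)
    then have "inv_pair (m * n) (elem_mat m n (Neg m) (A m)) (elem_mat m n (Neg m) Y)"
      by (intro elem_mat_end_inv_pair(2) assms(1))
    then show ?thesis
      using inv_pair_sym[OF inv_pair_mat_inverse] 2 assms(1) by simp
  next
    case 3
    then show ?thesis
      using elem_mat_inv_pair(1)[of "- A k" n k m] A by simp
  qed
qed

text \<open>If \<open>\<omega> = (a, m, b)\<close>, multiplying \<open>\<lambda>M\<^sub>-\<^sub>\<omega> - M\<^sub>\<sigma>\<close> by the inverses of \<open>M\<^sub>-\<^sub>a\<close> and \<open>M\<^sub>-\<^sub>b\<close> isolates
  \<open>M\<^sub>-\<^sub>m\<close>. These inverses are \<open>M\<close> over the reversed tuples \<open>a\<close> and \<open>b\<close>.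

  If \<open>\<sigma> = (a, m, b)\<close>, then \<open>M\<^sub>m\<close> is invertible and \<open>M\<^sub>-\<^sub>\<omega>\<close> is invertible as a whole, but \<open>M\<^sub>a\<close> or
  \<open>M\<^sub>b\<close> may be singular, because \<open>M\<^sub>0\<close> may occur in it. It occurs in at most one of them, and the
  other one can be carried around: with \<open>M\<^sub>b\<close> invertible, multiplying on the right by the inverse of
  \<open>M\<^sub>m M\<^sub>b\<close> and on the left by \<open>M\<^sub>b\<close> and the inverse of \<open>M\<^sub>-\<^sub>\<omega>\<close> leaves
  \<open>\<lambda>M\<^sub>-\<^sub>m - M\<^sub>b M\<^sub>-\<^sub>\<omega>\<^sup>-\<^sup>1 M\<^sub>a\<close>. With \<open>M\<^sub>a\<close> invertible the mirror image of this leads to the same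
  pencil.\<close>

lemma gfp_strictly_equivalent:
  assumes m: "1 \<le> m" and A: "\<And>i. i \<le> m \<Longrightarrow> A i \<in> carrier_mat n n"
    and perm: "distinct (\<sigma> @ \<omega>)" "set (\<sigma> @ \<omega>) = Pos ` {0..m}"
    and Am: "Pos m \<in> set \<sigma> \<Longrightarrow> invertible_mat (A m)"
    and A0: "Pos 0 \<in> set \<omega> \<Longrightarrow> invertible_mat (A 0)"
  obtains r where "distinct r" "set r = {0..<m}"
    "strictly_equivalent (m * n) (fiedler_prod m n A \<sigma>) (fiedler_prod m n A (map neg_idx \<omega>))
       (pos_prod m n (\<lambda>i. - A i) r) (elem_mat m n (Neg m) (A m))"
proof -
  define N where "N = m * n"
  define G where "G = fiedler_mat m n A"
  define F where "F t = mat_prod N (map G t)" for t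
  define D where "D t = mat_prod N (map (\<lambda>i. G (neg_idx i)) t)" for t
  have pair: "inv_pair N (G i) (G (neg_idx i))"
    if "i \<in> set \<sigma> - {Pos 0} \<union> (set \<omega> - {Pos m})" for i
  proof -
    have "i \<in> Pos ` {0..m}" using that perm(2) by auto
    then obtain k where k: "i = Pos k" "k \<le> m" by auto
    have "inv_pair N (fiedler_mat m n A (Pos k)) (fiedler_mat m n A (Neg k))"
      unfolding N_def using that k A0 Am by (intro fiedler_mat_inv_pair[OF m A]) auto
    then show ?thesis using k by (simp add: G_def)
  qed
  have Pos_lt: "G (Pos k) = elem_mat m n (Pos k) (- A k)" if "k < m" for k
    using that by (simp add: G_def)
  have Neg_m: "G (Neg m) = elem_mat m n (Neg m) (A m)"
    using m by (simp add: G_def)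
  have G_Neg_m: "G (Neg m) \<in> carrier_mat N N"
    unfolding Neg_m N_def using A m by (intro elem_mat_carrier) auto
  have Gc: "G i \<in> carrier_mat N N" if "i \<in> set \<sigma> \<union> set \<omega>" "i \<noteq> Pos m \<or> Pos m \<in> set \<sigma>" for i
  proof -
    have "i \<in> Pos ` {0..m}" using that perm(2) by auto
    then obtain k where k: "i = Pos k" "k \<le> m" by auto
    show ?thesis
    proof (cases "k < m")
      case True
      then show ?thesis unfolding k Pos_lt[OF True] N_def using A k by (intro elem_mat_carrier) auto
    next
      case False
      then show ?thesis using k that m pair[of "Pos m"] by (auto dest: inv_pair_carrier)
    qed
  qed
  have Gs: "set (map G t) \<subseteq> carrier_mat N N"
    if t: "set t \<subseteq> set \<sigma> \<union> set \<omega>" "Pos m \<in> set t \<Longrightarrow> Pos m \<in> set \<sigma>" for t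
  proof
    fix M assume "M \<in> set (map G t)"
    then obtain i where i: "i \<in> set t" "M = G i" by auto
    then have "i \<in> set \<sigma> \<union> set \<omega>" "i \<noteq> Pos m \<or> Pos m \<in> set \<sigma>" using t by blast+
    then show "M \<in> carrier_mat N N" using Gc i(2) by simp
  qed
  have Fc: "F t \<in> carrier_mat N N" if "set t \<subseteq> set \<sigma> \<union> set \<omega>" "Pos m \<in> set t \<Longrightarrow> Pos m \<in> set \<sigma>" for t
    unfolding F_def using that by (intro mat_prod_carrier Gs)
  have Fapp: "F (s @ t) = F s * F t"
    if "set s \<union> set t \<subseteq> set \<sigma> \<union> set \<omega>" "Pos m \<in> set s \<union> set t \<Longrightarrow> Pos m \<in> set \<sigma>" for s t
    unfolding F_def map_append using that by (intro mat_prod_append Gs) auto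
  have FD: "inv_pair N (F t) (D (rev t))" if "set t \<subseteq> set \<sigma> - {Pos 0} \<union> (set \<omega> - {Pos m})" for t
    unfolding F_def D_def using that pair by (intro inv_pair_mat_prod) auto
  have prods: "fiedler_prod m n A \<sigma> = F \<sigma>" "fiedler_prod m n A (map neg_idx \<omega>) = D \<omega>"
    by (simp_all add: fiedler_prod_def F_def D_def N_def G_def comp_def)
  have "\<exists>\<rho>. distinct \<rho> \<and> set \<rho> = set (\<sigma> @ \<omega>) - {Pos m} \<and>
    strictly_equivalent N (F \<sigma>) (D \<omega>) (F \<rho>) (G (Neg m))"
  proof (cases "Pos m \<in> set \<omega>")
    case True
    then obtain a b where \<omega>: "\<omega> = a @ Pos m # b" by (auto simp: in_set_conv_decomp)
    have mem: "Pos m \<notin> set a" "Pos m \<notin> set b" "Pos m \<notin> set \<sigma>"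
      using perm(1) \<omega> by auto
    have pa: "inv_pair N (F (rev a)) (D a)" and pb: "inv_pair N (F (rev b)) (D b)"
      using FD[of "rev a"] FD[of "rev b"] mem \<omega> by auto
    have c: "F (rev a) \<in> carrier_mat N N" "D a \<in> carrier_mat N N" "F (rev b) \<in> carrier_mat N N"
      "D b \<in> carrier_mat N N" "D b * F (rev b) = 1\<^sub>m N"
      using pa pb by (auto simp: inv_pair_def)
    have F\<sigma>: "F \<sigma> \<in> carrier_mat N N" using Fc by auto
    have D\<omega>: "D \<omega> = D a * (G (Neg m) * D b)"
    proof -
      have "set (map (\<lambda>i. G (neg_idx i)) a) \<subseteq> carrier_mat N N"
        "set (map (\<lambda>i. G (neg_idx i)) b) \<subseteq> carrier_mat N N"
        using pair mem \<omega> by (auto dest: inv_pair_carrier)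
      then show ?thesis
        unfolding D_def \<omega> using G_Neg_m by (simp add: mat_prod_append)
    qed
    have D\<omega>c: "D \<omega> \<in> carrier_mat N N" unfolding D\<omega> using c G_Neg_m by auto
    have "F (rev a @ \<sigma> @ rev b) = F (rev a) * (F \<sigma> * F (rev b))"
    proof -
      have "F (rev a @ \<sigma> @ rev b) = F (rev a) * F (\<sigma> @ rev b)"
        by (rule Fapp) (use mem \<omega> in auto)
      also have "F (\<sigma> @ rev b) = F \<sigma> * F (rev b)"
        by (rule Fapp) (use mem \<omega> in auto)
      finally show ?thesis .
    qed
    also have "\<dots> = F (rev a) * F \<sigma> * F (rev b)"
      using c F\<sigma> by (simp add: assoc_mult_mat[of _ N N _ N _ N])
    finally have 1: "F (rev a @ \<sigma> @ rev b) = F (rev a) * F \<sigma> * F (rev b)" .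
    have "F (rev a) * D \<omega> * F (rev b) = F (rev a) * (D a * (G (Neg m) * (D b * F (rev b))))"
      unfolding D\<omega> using c(1-4) G_Neg_m by (simp add: assoc_mult_mat[of _ N N _ N _ N])
    also have "\<dots> = G (Neg m)"
      unfolding c(5) using inv_pair_cancel(1)[OF pa G_Neg_m] G_Neg_m by simp
    finally have 2: "F (rev a) * D \<omega> * F (rev b) = G (Neg m)" .
    show ?thesis
      using perm(1) mem \<omega> by (intro exI[of _ "rev a @ \<sigma> @ rev b"] conjI
          strictly_equivalentI[OF pa pb F\<sigma> D\<omega>c 1 2[symmetric]]) auto
  next
    case False
    then have "Pos m \<in> set \<sigma>" using perm(2) by auto
    then obtain a b where \<sigma>: "\<sigma> = a @ Pos m # b" by (auto simp: in_set_conv_decomp)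
    have p\<omega>: "inv_pair N (F (rev \<omega>)) (D \<omega>)"
      using FD[of "rev \<omega>"] False by auto
    have pm: "inv_pair N (G (Pos m)) (G (Neg m))"
      using pair[of "Pos m"] \<sigma> m by auto
    have a: "F a \<in> carrier_mat N N" and b: "F b \<in> carrier_mat N N"
      using \<sigma> by (auto intro!: Fc)
    have c: "F (rev \<omega>) \<in> carrier_mat N N" "D \<omega> \<in> carrier_mat N N" "F (rev \<omega>) * D \<omega> = 1\<^sub>m N"
      "D \<omega> * F (rev \<omega>) = 1\<^sub>m N" "G (Pos m) \<in> carrier_mat N N" "G (Pos m) * G (Neg m) = 1\<^sub>m N"
      "G (Neg m) * G (Pos m) = 1\<^sub>m N"
      using p\<omega> pm by (auto simp: inv_pair_def)
    have F\<sigma>: "F \<sigma> = F a * (G (Pos m) * F b)"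
    proof -
      have "F (a @ Pos m # b) = F a * F (Pos m # b)"
        by (rule Fapp) (use \<sigma> in auto)
      then show ?thesis using \<sigma> by (simp add: F_def)
    qed
    have F\<sigma>c: "F \<sigma> \<in> carrier_mat N N" unfolding F\<sigma> using a b c by auto
    have \<rho>: "F (b @ rev \<omega> @ a) = F b * (F (rev \<omega>) * F a)"
    proof -
      have "F (b @ rev \<omega> @ a) = F b * F (rev \<omega> @ a)"
        by (rule Fapp) (use \<sigma> in auto)
      also have "F (rev \<omega> @ a) = F (rev \<omega>) * F a"
        by (rule Fapp) (use \<sigma> in auto)
      finally show ?thesis .
    qed
    have d: "distinct (b @ rev \<omega> @ a)" "set (b @ rev \<omega> @ a) = set (\<sigma> @ \<omega>) - {Pos m}"
      using perm(1) \<sigma> by auto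
    have "Pos 0 \<notin> set a \<or> Pos 0 \<notin> set b" using perm(1) \<sigma> by auto
    then show ?thesis
    proof
      assume "Pos 0 \<notin> set b"
      then have pb: "inv_pair N (F b) (D (rev b))" using \<sigma> by (intro FD) auto
      note b' = inv_pair_carrier(2)[OF pb]
      have 1: "F (b @ rev \<omega> @ a) = (F b * F (rev \<omega>)) * F \<sigma> * (D (rev b) * G (Neg m))"
      proof -
        have "(F b * F (rev \<omega>)) * F \<sigma> * (D (rev b) * G (Neg m)) =
          F b * (F (rev \<omega>) * (F a * (G (Pos m) * (F b * (D (rev b) * G (Neg m))))))"
          unfolding F\<sigma> using a b b' c(1,5) G_Neg_m by (simp add: assoc_mult_mat[of _ N N _ N _ N])
        also have "\<dots> = F b * (F (rev \<omega>) * F a)"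
          unfolding inv_pair_cancel(1)[OF pb G_Neg_m] c(6) using a by simp
        finally show ?thesis using \<rho> by simp
      qed
      have 2: "G (Neg m) = (F b * F (rev \<omega>)) * D \<omega> * (D (rev b) * G (Neg m))"
      proof -
        have "(F b * F (rev \<omega>)) * D \<omega> * (D (rev b) * G (Neg m)) =
          F b * (F (rev \<omega>) * (D \<omega> * (D (rev b) * G (Neg m))))"
          using b b' c(1,2) G_Neg_m by (simp add: assoc_mult_mat[of _ N N _ N _ N])
        then show ?thesis
          using inv_pair_cancel(1)[OF p\<omega>, of "D (rev b) * G (Neg m)"] inv_pair_cancel(1)[OF pb G_Neg_m]
            b' G_Neg_m by simp
      qed
      show ?thesis
        using d strictly_equivalentI[OF inv_pair_mult[OF pb p\<omega>]
            inv_pair_mult[OF inv_pair_sym[OF pb] inv_pair_sym[OF pm]] F\<sigma>c c(2) 1 2] by blast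
    next
      assume "Pos 0 \<notin> set a"
      then have pa: "inv_pair N (F a) (D (rev a))" using \<sigma> by (intro FD) auto
      note a' = inv_pair_carrier(2)[OF pa]
      have aa: "D (rev a) * F a = 1\<^sub>m N" using pa by (simp add: inv_pair_def)
      have ra: "F (rev \<omega>) * F a \<in> carrier_mat N N" using a c by auto
      have 1: "F (b @ rev \<omega> @ a) = (G (Neg m) * D (rev a)) * F \<sigma> * (F (rev \<omega>) * F a)"
      proof -
        have "(G (Neg m) * D (rev a)) * F \<sigma> * (F (rev \<omega>) * F a) =
          G (Neg m) * (D (rev a) * (F a * (G (Pos m) * (F b * (F (rev \<omega>) * F a)))))"
          unfolding F\<sigma> using a b a' c(1,5) G_Neg_m by (simp add: assoc_mult_mat[of _ N N _ N _ N])
        also have "\<dots> = F b * (F (rev \<omega>) * F a)"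
          using inv_pair_cancel(2)[OF pa, of "G (Pos m) * (F b * (F (rev \<omega>) * F a))"]
            inv_pair_cancel(2)[OF pm, of "F b * (F (rev \<omega>) * F a)"] b ra c(5) by simp
        finally show ?thesis using \<rho> by simp
      qed
      have 2: "G (Neg m) = (G (Neg m) * D (rev a)) * D \<omega> * (F (rev \<omega>) * F a)"
      proof -
        have "(G (Neg m) * D (rev a)) * D \<omega> * (F (rev \<omega>) * F a) =
          G (Neg m) * (D (rev a) * (D \<omega> * (F (rev \<omega>) * F a)))"
          using a a' c(1,2) G_Neg_m by (simp add: assoc_mult_mat[of _ N N _ N _ N])
        then show ?thesis
          using inv_pair_cancel(2)[OF p\<omega> a] aa G_Neg_m by simp
      qed
      show ?thesis
        using d strictly_equivalentI[OF inv_pair_mult[OF inv_pair_sym[OF pm] inv_pair_sym[OF pa]]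
            inv_pair_mult[OF p\<omega> pa] F\<sigma>c c(2) 1 2] by blast
    qed
  qed
  then obtain \<rho> where \<rho>: "distinct \<rho>" "set \<rho> = set (\<sigma> @ \<omega>) - {Pos m}"
    "strictly_equivalent N (F \<sigma>) (D \<omega>) (F \<rho>) (G (Neg m))" by blast
  have set\<rho>: "set \<rho> = Pos ` {0..<m}" using \<rho>(2) perm(2) by auto
  then have "\<forall>i\<in>set \<rho>. \<exists>k. i = Pos k" by auto
  then obtain r where r: "\<rho> = map Pos r" using ex_map_conv[of \<rho> Pos] by blast
  have "Pos ` set r = Pos ` {0..<m}" using set\<rho> r by simp
  then have "set r = {0..<m}" by (subst (asm) inj_image_eq_iff) (auto simp: inj_def)
  moreover have "distinct r" using \<rho>(1) r by (simp add: distinct_map)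
  moreover have "F \<rho> = pos_prod m n (\<lambda>i. - A i) r"
    unfolding F_def pos_prod_def r N_def using Pos_lt calculation(1) by (auto intro!: arg_cong[where f = "mat_prod _"])
  ultimately show thesis
    using that \<rho>(3) Neg_m prods N_def by simp
qed

section \<open>Reversal by flipping rows and columns\<close>

text \<open>Reverses the order of all rows and of all columns, inside the blocks as well. A flip of the
  block order alone would fit the elementary matrices just as well, but this one needs no division
  of indices by \<open>n\<close>.\<close>

definition flip_mat :: "'a mat \<Rightarrow> 'a mat" where
  "flip_mat M = mat (dim_row M) (dim_col M) (\<lambda>(i, j). M $$ (dim_row M - Suc i, dim_col M - Suc j))"

definition exchange_mat :: "nat \<Rightarrow> 'a::semiring_1 mat" where
  "exchange_mat N = mat N N (\<lambda>(i, j). if i + j + 1 = N then 1 else 0)"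

lemma flip_mat_carrier [simp]: "M \<in> carrier_mat a b \<Longrightarrow> flip_mat M \<in> carrier_mat a b"
  by (auto simp: flip_mat_def)

lemma flip_mat_flip_mat [simp]: "flip_mat (flip_mat M) = M"
  by (rule eq_matI) (auto simp: flip_mat_def)

lemma flip_mat_one [simp]: "flip_mat (1\<^sub>m n) = 1\<^sub>m n"
  by (rule eq_matI) (auto simp: flip_mat_def)

lemma flip_mat_uminus: "flip_mat (- M) = - flip_mat M"
  by (rule eq_matI) (auto simp: flip_mat_def)

lemma flip_mat_four_block:
  assumes "A \<in> carrier_mat a b" "B \<in> carrier_mat a d" "C \<in> carrier_mat c b" "D \<in> carrier_mat c d"
  shows "flip_mat (four_block_mat A B C D)
    = four_block_mat (flip_mat D) (flip_mat C) (flip_mat B) (flip_mat A)"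
    (is "?L = ?R")
proof (rule eq_matI)
  fix i j assume "i < dim_row ?R" "j < dim_col ?R"
  then have "i < c + a" "j < d + b" using assms by (simp_all add: flip_mat_def)
  then show "?L $$ (i, j) = ?R $$ (i, j)"
    using assms by (auto simp: flip_mat_def intro!: arg_cong[where f = "($$) _"])
qed (use assms in \<open>simp_all add: flip_mat_def\<close>)

lemma flip_mat_zero [simp]: "flip_mat (0\<^sub>m a b) = 0\<^sub>m a b"
  by (rule eq_matI) (auto simp: flip_mat_def)

lemma flip_mat_dim [simp]: "dim_row (flip_mat M) = dim_row M" "dim_col (flip_mat M) = dim_col M"
  by (simp_all add: flip_mat_def)

lemma flip_mat_dsum: "flip_mat (A \<oplus>\<^sub>d D) = flip_mat D \<oplus>\<^sub>d flip_mat A"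
  unfolding dsum_def by (subst flip_mat_four_block) (auto intro: carrier_matI)

lemma exchange_mat_carrier: "exchange_mat N \<in> carrier_mat N N"
  by (simp add: exchange_mat_def)

text \<open>Flipping is conjugation by an involution, hence multiplicative, and a unimodular reduction.\<close>

lemma exchange_conj:
  assumes "M \<in> carrier_mat N N"
  shows "exchange_mat N * M * exchange_mat N = flip_mat M"
proof -
  have 1: "(exchange_mat N * M) $$ (i, j) = M $$ (N - Suc i, j)" if "i < N" "j < N" for i j
  proof -
    have "(exchange_mat N * M) $$ (i, j) = (\<Sum>k\<in>{0..<N}. (if i + k + 1 = N then 1 else 0) * M $$ (k, j))"
      using that assms by (simp add: scalar_prod_def exchange_mat_def)
    also have "\<dots> = (\<Sum>k\<in>{0..<N}. if k = N - Suc i then M $$ (k, j) else 0)"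
      using that by (intro sum.cong) auto
    finally show ?thesis using that by simp
  qed
  have 2: "(Z * exchange_mat N) $$ (i, j) = Z $$ (i, N - Suc j)"
    if "i < N" "j < N" "Z \<in> carrier_mat N N" for i j and Z :: "'a mat"
  proof -
    have "(Z * exchange_mat N) $$ (i, j) = (\<Sum>k\<in>{0..<N}. Z $$ (i, k) * (if k + j + 1 = N then 1 else 0))"
      using that by (simp add: scalar_prod_def exchange_mat_def)
    also have "\<dots> = (\<Sum>k\<in>{0..<N}. if k = N - Suc j then Z $$ (i, k) else 0)"
      using that by (intro sum.cong) auto
    finally show ?thesis using that by simp
  qed
  show ?thesis
  proof (rule eq_matI)
    fix i j assume "i < dim_row (flip_mat M)" "j < dim_col (flip_mat M)"
    then have ij: "i < N" "j < N" using assms by (simp_all add: flip_mat_def)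
    have "exchange_mat N * M \<in> carrier_mat N N" using assms by (metis exchange_mat_carrier mult_carrier_mat)
    then show "(exchange_mat N * M * exchange_mat N) $$ (i, j) = flip_mat M $$ (i, j)"
      using 2[OF ij] 1[of i "N - Suc j"] ij assms by (simp add: flip_mat_def)
  qed (use assms in \<open>simp_all add: flip_mat_def exchange_mat_def\<close>)
qed

lemma exchange_mat_self_inverse: "exchange_mat N * exchange_mat N = 1\<^sub>m N"
  using exchange_conj[of "1\<^sub>m N" N] by (simp add: right_mult_one_mat[OF exchange_mat_carrier])

lemma flip_mat_mult:
  fixes A B :: "complex mat"
  assumes "A \<in> carrier_mat N N" "B \<in> carrier_mat N N"
  shows "flip_mat (A * B) = flip_mat A * flip_mat B"
proof -
  let ?J = "exchange_mat N :: complex mat"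
  have Jc: "?J \<in> carrier_mat N N" by (rule exchange_mat_carrier)
  have J: "inv_pair N ?J ?J" by (simp add: inv_pair_def exchange_mat_self_inverse exchange_mat_carrier)
  have "?J * A * ?J * (?J * B * ?J) = ?J * (A * (?J * (?J * (B * ?J))))"
    using assms Jc by (simp add: assoc_mult_mat[of _ N N _ N _ N])
  also have "\<dots> = ?J * (A * (B * ?J))"
    using inv_pair_cancel(1)[OF J mult_carrier_mat[OF assms(2) Jc]] by simp
  also have "\<dots> = ?J * (A * B) * ?J"
    using assms Jc by (simp add: assoc_mult_mat[of _ N N _ N _ N])
  finally show ?thesis
    using exchange_conj[OF assms(1)] exchange_conj[OF assms(2)] exchange_conj[of "A * B" N] assms by simp
qed

lemma flip_mat_mat_prod:
  "set Ms \<subseteq> carrier_mat N N \<Longrightarrow> flip_mat (mat_prod N Ms) = mat_prod N (map flip_mat Ms)"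
  by (induction Ms) (simp_all add: flip_mat_mult[of _ N])

lemma reduces_flip:
  assumes "L \<in> carrier_mat N N"
  shows "reduces N L (flip_mat L)"
proof -
  have "const_mat (exchange_mat N) = exchange_mat N"
    unfolding const_mat_def exchange_mat_def by (rule eq_matI) auto
  then show ?thesis
    using reduces_const[OF exchange_mat_carrier exchange_mat_carrier exchange_mat_self_inverse
        exchange_mat_carrier exchange_mat_carrier exchange_mat_self_inverse assms]
      exchange_conj[OF assms] by simp
qed

lemma flip_mat_pencil:
  assumes "X \<in> carrier_mat N N" "Y \<in> carrier_mat N N"
  shows "flip_mat (pencil X Y) = pencil (flip_mat X) (flip_mat Y)"
  using assms unfolding pencil_def const_mat_def flip_mat_def by (intro eq_matI) auto

lemma flip_mat_swap_block:
  assumes "X \<in> carrier_mat n n"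
  shows "flip_mat (swap_block n X) = swap_block_inv n (flip_mat X)"
  using assms unfolding swap_block_def swap_block_inv_def
  by (simp add: flip_mat_four_block[of _ n n _ n _ n])

text \<open>Block row \<open>i\<close> from the bottom becomes block row \<open>i\<close> from the top, and the corner that holds \<open>X\<close> moves
  to the opposite corner of the active block. For \<open>k = 0\<close> the right-hand side is \<open>M\<^sub>-\<^sub>m\<close>.\<close>

lemma flip_mat_elem_mat:
  assumes "X \<in> carrier_mat n n" "k < m"
  shows "flip_mat (elem_mat m n (Pos k) X) = elem_mat m n (Neg (m - k)) (flip_mat X)"
proof (cases "k = 0")
  case True
  then show ?thesis by (simp add: elem_mat_Pos elem_mat_Neg flip_mat_dsum)
next
  case False
  then have "m - (m - k) - 1 = k - 1" "m - k \<noteq> m" using assms(2) by auto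
  then show ?thesis using False assms
    by (simp only: elem_mat_Pos elem_mat_Neg flip_mat_dsum flip_mat_swap_block flip_mat_one dsum_assoc if_False)
qed

text \<open>All factors except \<open>M\<^sub>0\<close> are inner and hence invertible. Carrying them to the other coefficient
  leaves \<open>M\<^sub>0\<close> alone on one side and on the other a product \<open>Q\<close> of the \<open>M\<^sub>-\<^sub>i\<close> with \<open>1 \<le> i \<le> m\<close>. The
  flip turns \<open>Q\<close> into a product over a permutation \<open>s\<close> of \<open>{0:m-1}\<close>.\<close>

lemma fiedler_pencil_reversal:
  assumes m: "1 \<le> m" and A: "\<And>i. i \<le> m \<Longrightarrow> A i \<in> carrier_mat n n"
    and r: "distinct r" "set r = {0..<m}"
  obtains s Q where "distinct s" "set s = {0..<m}" "Q \<in> carrier_mat (m * n) (m * n)"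
    "flip_mat Q = pos_prod m n (\<lambda>i. flip_mat (A (m - i))) s"
    "strictly_equivalent (m * n) (pos_prod m n (\<lambda>i. - A i) r) (elem_mat m n (Neg m) (A m))
      (elem_mat m n (Pos 0) (- A 0)) Q"
proof -
  define N where "N = m * n"
  define P where "P t = mat_prod N (map (\<lambda>i. elem_mat m n (Pos i) (- A i)) t)" for t
  define E where "E t = mat_prod N (map (\<lambda>i. elem_mat m n (Neg i) (A i)) t)" for t
  have "0 \<in> set r" using r m by simp
  then obtain a b where ab: "r = a @ 0 # b" by (auto simp: in_set_conv_decomp)
  have sub: "set a \<subseteq> {1..<m}" "set b \<subseteq> {1..<m}"
  proof -
    have "i \<in> {1..<m}" if "i \<in> set a \<union> set b" for i
    proof -
      have "i \<in> set r" "i \<noteq> 0" using that r(1) ab by auto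
      then show ?thesis using r(2) by simp
    qed
    then show "set a \<subseteq> {1..<m}" "set b \<subseteq> {1..<m}" by blast+
  qed
  have pair: "inv_pair N (P t) (E (rev t))" if "set t \<subseteq> {1..<m}" for t
    unfolding P_def E_def N_def
  proof (rule inv_pair_mat_prod)
    fix i assume "i \<in> set t"
    then have i: "1 \<le> i" "i < m" using that by auto
    then show "inv_pair (m * n) (elem_mat m n (Pos i) (- A i)) (elem_mat m n (Neg i) (A i))"
      using elem_mat_inv_pair(1)[of "- A i" n i m] A[of i] by simp
  qed
  have Nc: "elem_mat m n (Neg i) (A i) \<in> carrier_mat N N" if "1 \<le> i" "i \<le> m" for i
    unfolding N_def using that A by (intro elem_mat_carrier) auto
  have Pc: "elem_mat m n (Pos i) (- A i) \<in> carrier_mat N N" if "i < m" for i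
    unfolding N_def using that A by (intro elem_mat_carrier) auto
  let ?M0 = "elem_mat m n (Pos 0) (- A 0)" and ?Mm = "elem_mat m n (Neg m) (A m)"
  define u where "u = rev a @ m # rev b"
  have M0: "?M0 \<in> carrier_mat N N" and Mm: "?Mm \<in> carrier_mat N N"
    using Pc[of 0] Nc[of m] m by auto
  note c = inv_pair_carrier[OF pair[OF sub(1)]] inv_pair_carrier[OF pair[OF sub(2)]]
  have pos: "pos_prod m n (\<lambda>i. - A i) r = P a * (?M0 * P b)"
  proof -
    have "set (map (\<lambda>i. elem_mat m n (Pos i) (- A i)) a) \<subseteq> carrier_mat N N"
      "set (map (\<lambda>i. elem_mat m n (Pos i) (- A i)) (0 # b)) \<subseteq> carrier_mat N N"
      using Pc sub m by fastforce+
    then show ?thesis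
      unfolding pos_prod_def P_def N_def[symmetric] ab map_append by (subst mat_prod_append) simp_all
  qed
  have posc: "pos_prod m n (\<lambda>i. - A i) r \<in> carrier_mat N N"
    unfolding pos using c M0 by auto
  have Eu: "E u = E (rev a) * ?Mm * E (rev b)"
  proof -
    have "set (map (\<lambda>i. elem_mat m n (Neg i) (A i)) (rev a)) \<subseteq> carrier_mat N N"
      "set (map (\<lambda>i. elem_mat m n (Neg i) (A i)) (m # rev b)) \<subseteq> carrier_mat N N"
      using Nc sub m by auto
    then have "E u = E (rev a) * (?Mm * E (rev b))"
      unfolding E_def u_def map_append by (subst mat_prod_append) simp_all
    then show ?thesis using c Mm by (simp add: assoc_mult_mat[of _ N N _ N _ N])
  qed
  have M0_eq: "?M0 = E (rev a) * pos_prod m n (\<lambda>i. - A i) r * E (rev b)"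
  proof -
    have "E (rev a) * pos_prod m n (\<lambda>i. - A i) r * E (rev b) =
      E (rev a) * (P a * (?M0 * (P b * E (rev b))))"
      unfolding pos using c M0 by (simp add: assoc_mult_mat[of _ N N _ N _ N])
    then show ?thesis
      using pair[OF sub(2)] inv_pair_cancel(2)[OF pair[OF sub(1)] M0] M0 by (simp add: inv_pair_def)
  qed
  have equiv: "strictly_equivalent N (pos_prod m n (\<lambda>i. - A i) r) ?Mm ?M0 (E u)"
    by (rule strictly_equivalentI[OF inv_pair_sym[OF pair[OF sub(1)]] inv_pair_sym[OF pair[OF sub(2)]]
          posc Mm M0_eq Eu])
  have u: "distinct u" "set u = {1..m}"
  proof -
    have "m \<notin> set a" "m \<notin> set b" using sub by fastforce+
    then show "distinct u" using r(1) unfolding u_def ab by (simp add: Int_commute)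
    have ab': "set a \<union> set b = {1..<m}"
    proof
      show "{1..<m} \<subseteq> set a \<union> set b"
      proof
        fix i assume "i \<in> {1..<m}"
        then have "i \<in> set r" "i \<noteq> 0" using r(2) by auto
        then show "i \<in> set a \<union> set b" using ab by auto
      qed
    qed (use sub in blast)
    have "set u = insert m (set a \<union> set b)" unfolding u_def by simp
    also have "\<dots> = {1..m}" unfolding ab' using m by auto
    finally show "set u = {1..m}" .
  qed
  let ?s = "map (\<lambda>k. m - k) u"
  have s: "distinct ?s" "set ?s = {0..<m}"
  proof -
    show "distinct ?s" using u by (auto simp: distinct_map inj_on_def)
    have "i \<in> (\<lambda>k. m - k) ` {1..m}" if "i < m" for i
      using that by (intro image_eqI[of _ _ "m - i"]) auto
    then show "set ?s = {0..<m}" using u(2) m by auto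
  qed
  have Ec: "E u \<in> carrier_mat N N"
    unfolding Eu using c Mm by auto
  have "flip_mat (E u) = mat_prod N (map flip_mat (map (\<lambda>i. elem_mat m n (Neg i) (A i)) u))"
    unfolding E_def by (rule flip_mat_mat_prod) (use Nc u(2) in auto)
  also have "map flip_mat (map (\<lambda>i. elem_mat m n (Neg i) (A i)) u)
      = map (\<lambda>i. elem_mat m n (Pos i) (flip_mat (A (m - i)))) ?s"
  proof -
    have "flip_mat (elem_mat m n (Neg i) (A i)) = elem_mat m n (Pos (m - i)) (flip_mat (A (m - (m - i))))"
      if "i \<in> {1..m}" for i
    proof -
      have i: "m - i < m" "m - (m - i) = i" using that by auto
      have "flip_mat (A i) \<in> carrier_mat n n" using A that by simp
      from flip_mat_elem_mat[OF this i(1)]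
      have "flip_mat (elem_mat m n (Pos (m - i)) (flip_mat (A i))) = elem_mat m n (Neg i) (A i)"
        using i(2) by simp
      then have "flip_mat (elem_mat m n (Neg i) (A i)) = elem_mat m n (Pos (m - i)) (flip_mat (A i))"
        by (metis flip_mat_flip_mat)
      then show ?thesis using i(2) by simp
    qed
    then show ?thesis using u(2) by (simp add: comp_def)
  qed
  finally have "flip_mat (E u) = pos_prod m n (\<lambda>i. flip_mat (A (m - i))) ?s"
    by (simp only: pos_prod_def N_def)
  then show thesis
    using that[OF s] Ec equiv unfolding N_def by blast
qed

lemma uminus_add_eq_minus_mat:
  fixes P Q :: "'a::ab_group_add mat"
  assumes "P \<in> carrier_mat a b" "Q \<in> carrier_mat a b"
  shows "- P + Q = Q - P"
  using assms by (intro eq_matI) auto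

lemma fiedler_pencil_reduces:
  assumes m: "1 \<le> m" and A: "\<And>i. i \<le> m \<Longrightarrow> A i \<in> carrier_mat n n"
    and r: "distinct r" "set r = {0..<m}"
  shows "reduces (m * n) (pencil (- pos_prod m n (\<lambda>i. - A i) r) (elem_mat m n (Neg m) (A m)))
    (1\<^sub>m ((m - 1) * n) \<oplus>\<^sub>d mat_polynomial n m A)"
proof -
  obtain k where k: "m = Suc k" using m by (cases m) auto
  have P: "pos_prod m n (\<lambda>i. - A i) r \<in> carrier_mat (m * n) (m * n)"
    using A r by (intro pos_prod_carrier) auto
  have E: "elem_mat m n (Neg m) (A m) = A m \<oplus>\<^sub>d 1\<^sub>m (k * n)"
    by (simp add: elem_mat_Neg k)
  have Ec: "const_mat (A m) \<oplus>\<^sub>d 1\<^sub>m (k * n) \<in> carrier_mat (m * n) (m * n)"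
    using A[of m] k by simp
  have "pencil (- pos_prod m n (\<lambda>i. - A i) r) (elem_mat m n (Neg m) (A m))
    = [:0, 1:] \<cdot>\<^sub>m (const_mat (A m) \<oplus>\<^sub>d 1\<^sub>m (k * n)) - const_mat (pos_prod m n (\<lambda>i. - A i) r)"
    unfolding pencil_def E const_mat_dsum const_mat_one const_mat_uminus
    using P Ec by (intro uminus_add_eq_minus_mat[of _ "m * n" "m * n"]) auto
  moreover have "reduces (Suc k * n)
    ([:0, 1:] \<cdot>\<^sub>m (const_mat (A m) \<oplus>\<^sub>d 1\<^sub>m (k * n)) - const_mat (pos_prod (Suc k) n (\<lambda>i. - A i) r))
    (1\<^sub>m (k * n) \<oplus>\<^sub>d poly_with_lead n (Suc k) (const_mat (A m)) A)"
    by (rule fiedler_pencil_horner) (use r A k in auto)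
  ultimately show ?thesis
    using poly_with_lead_const[of A m n] A[of m] k by simp
qed

text \<open>The sign matches the convention \<open>M\<^sub>i\<^sup>P = M\<^sub>i(-A\<^sub>i)\<close>: the flipped factors \<open>M\<^sub>m\<^sub>-\<^sub>i(A\<^sub>i)\<close> belong to a
  polynomial whose coefficient at \<open>m - i\<close> is the negative of the flip of \<open>A\<^sub>i\<close>.\<close>

lemma rev_mat_polynomial:
  assumes A: "\<And>i. i \<le> m \<Longrightarrow> A i \<in> carrier_mat n n"
  shows "rev_mat m (mat_polynomial n m A) = - flip_mat (mat_polynomial n m (\<lambda>i. - flip_mat (A (m - i))))"
proof (rule eq_matI)
  let ?R = "- flip_mat (mat_polynomial n m (\<lambda>i. - flip_mat (A (m - i))))"
  fix i j assume "i < dim_row ?R" "j < dim_col ?R"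
  then have ij: "i < n" "j < n" by (simp_all add: flip_mat_def mat_polynomial_def)
  let ?a = "\<lambda>k. A k $$ (i, j)"
  have "coeff (\<Sum>l\<le>m. monom (?a l) l) k = ?a k" if "k \<le> m" for k
    using that by (simp add: coeff_sum if_distrib sum.delta cong: if_cong)
  then have "rev_mat m (mat_polynomial n m A) $$ (i, j) = (\<Sum>k\<le>m. monom (?a k) (m - k))"
    using ij by (simp add: rev_mat_def mat_polynomial_def rev_poly_def)
  also have "\<dots> = (\<Sum>k\<le>m. monom (?a (m - k)) k)"
    by (rule sum.reindex_bij_witness[of _ "\<lambda>k. m - k" "\<lambda>k. m - k"]) auto
  also have "\<dots> = ?R $$ (i, j)"
  proof -
    have "(- flip_mat (A (m - k))) $$ (n - Suc i, n - Suc j) = - ?a (m - k)" if "k \<le> m" for k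
      using ij A[of "m - k"] by (simp add: flip_mat_def)
    then show ?thesis
      using ij by (simp add: flip_mat_def mat_polynomial_def sum_negf[symmetric] minus_monom)
  qed
  finally show "rev_mat m (mat_polynomial n m A) $$ (i, j) = ?R $$ (i, j)" .
qed (simp_all add: rev_mat_def flip_mat_def mat_polynomial_def)

text \<open>Flipping, reducing the flipped Fiedler pencil and flipping back the remaining \<open>n \<times> n\<close> block.\<close>

lemma fiedler_pencil_reversal_reduces:
  assumes m: "1 \<le> m" and A: "\<And>i. i \<le> m \<Longrightarrow> A i \<in> carrier_mat n n"
    and r: "distinct r" "set r = {0..<m}"
  shows "reduces (m * n) (pencil (elem_mat m n (Neg m) (A m)) (- pos_prod m n (\<lambda>i. - A i) r))
    (1\<^sub>m ((m - 1) * n) \<oplus>\<^sub>d rev_mat m (mat_polynomial n m A))"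
proof -
  let ?N = "m * n" and ?B = "\<lambda>i. - flip_mat (A (m - i))"
  let ?Q = "mat_polynomial n m ?B"
  obtain s Q where s: "distinct s" "set s = {0..<m}" and Q: "Q \<in> carrier_mat ?N ?N"
    and flipQ: "flip_mat Q = pos_prod m n (\<lambda>i. flip_mat (A (m - i))) s"
    and eq: "strictly_equivalent ?N (pos_prod m n (\<lambda>i. - A i) r) (elem_mat m n (Neg m) (A m))
      (elem_mat m n (Pos 0) (- A 0)) Q"
    using fiedler_pencil_reversal[where A = A, OF m A r] by blast
  let ?M = "elem_mat m n (Pos 0) (- A 0)"
  have M: "?M \<in> carrier_mat ?N ?N" using A m by (intro elem_mat_carrier) auto
  have "reduces ?N (pencil (elem_mat m n (Neg m) (A m)) (- pos_prod m n (\<lambda>i. - A i) r)) (pencil Q (- ?M))"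
    by (rule strictly_equivalent_reduces(2)[OF eq])
  also have "pencil Q (- ?M) = - pencil (- Q) ?M"
    unfolding pencil_def const_mat_uminus using Q M by (intro eq_matI) auto
  finally have 1: "reduces ?N (pencil (elem_mat m n (Neg m) (A m)) (- pos_prod m n (\<lambda>i. - A i) r))
    (- pencil (- Q) ?M)" .
  have c: "pencil (- Q) ?M \<in> carrier_mat ?N ?N" using Q M by simp
  have 2: "reduces ?N (- pencil (- Q) ?M) (pencil (- Q) ?M)"
    using reduces_uminus[of "- pencil (- Q) ?M" ?N] c by simp
  have B: "?B i \<in> carrier_mat n n" if "i \<le> m" for i using A by simp
  have "flip_mat (pencil (- Q) ?M) = pencil (- pos_prod m n (\<lambda>i. - ?B i) s) (elem_mat m n (Neg m) (?B m))"
    using Q M m A[of 0] flip_mat_elem_mat[of "- A 0" n 0 m]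
    by (simp add: flip_mat_pencil[of _ ?N] flip_mat_uminus flipQ)
  then have 3: "reduces ?N (pencil (- Q) ?M) (pencil (- pos_prod m n (\<lambda>i. - ?B i) s) (elem_mat m n (Neg m) (?B m)))"
    using reduces_flip[OF c] by simp
  have 4: "reduces ?N (pencil (- pos_prod m n (\<lambda>i. - ?B i) s) (elem_mat m n (Neg m) (?B m)))
      (1\<^sub>m ((m - 1) * n) \<oplus>\<^sub>d ?Q)"
    by (rule fiedler_pencil_reduces[OF m B s])
  have Qc: "?Q \<in> carrier_mat n n" by (simp add: mat_polynomial_def)
  have "reduces n ?Q (- flip_mat ?Q)"
    using reduces_trans[OF reduces_flip[OF Qc] reduces_uminus] Qc by simp
  then have "reduces ((m - 1) * n + n) (1\<^sub>m ((m - 1) * n) \<oplus>\<^sub>d ?Q) (1\<^sub>m ((m - 1) * n) \<oplus>\<^sub>d (- flip_mat ?Q))"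
    by (rule reduces_dsum)
  then have "reduces ?N (1\<^sub>m ((m - 1) * n) \<oplus>\<^sub>d ?Q) (1\<^sub>m ((m - 1) * n) \<oplus>\<^sub>d rev_mat m (mat_polynomial n m A))"
    using rev_mat_polynomial[OF A] block_sizes1(1)[OF m, of n] by simp
  then show ?thesis
    by (rule reduces_trans[OF reduces_trans[OF reduces_trans[OF reduces_trans[OF 1 2] 3] 4]])
qed

section \<open>Extended generalized Fiedler pencils\<close>

lemma linearizationI:
  assumes "X \<in> carrier_mat (m * n) (m * n)" "Y \<in> carrier_mat (m * n) (m * n)"
    and "reduces (m * n) (pencil X Y) (1\<^sub>m ((m - 1) * n) \<oplus>\<^sub>d P)"
  shows "linearization m n P (pencil X Y)"
  using assms unfolding linearization_def reduces_def diag_block_mat_eq_dsum by blast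

theorem theorem3p4:
  fixes m n :: nat and A :: "nat \<Rightarrow> complex mat"
    and \<sigma> \<tau> \<sigma>1 \<sigma>2 \<tau>1 \<tau>2 :: "idx list"
    and X1 X2 Y1 Y2 :: "complex mat list"
    and L :: "complex poly mat"
  assumes "m \<ge> 2"
    and "\<And>i. i \<le> m \<Longrightarrow> A i \<in> carrier_mat n n"
    and "A m \<noteq> 0\<^sub>m n n"
    and "EGFP m n A \<sigma> \<tau> \<sigma>1 \<sigma>2 \<tau>1 \<tau>2 X1 X2 Y1 Y2 L"
    and "nonsingular_assignment m \<sigma>1 X1" and "nonsingular_assignment m \<sigma>2 X2"
    and "nonsingular_assignment m \<tau>1 Y1" and "nonsingular_assignment m \<tau>2 Y2"
  shows "strong_linearization m n (mat_polynomial n m A) L"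
proof -
  let ?N = "m * n"
  note E = assms(4)[unfolded EGFP_def]
  have m: "1 \<le> m" using assms(1) by simp
  note A = assms(2)
  obtain \<omega> where perm: "distinct (\<sigma> @ \<omega>)" "set (\<sigma> @ \<omega>) = Pos ` {0..m}" and \<tau>: "\<tau> = map neg_idx \<omega>"
    using E by blast
  have "Pos 0 \<in> set \<omega> \<Longrightarrow> Neg 0 \<in> set \<tau>"
    unfolding \<tau> by force
  then have inv: "Pos m \<in> set \<sigma> \<Longrightarrow> invertible_mat (A m)" "Pos 0 \<in> set \<omega> \<Longrightarrow> invertible_mat (A 0)"
    using E by blast+
  obtain r where r: "distinct r" "set r = {0..<m}"
    and red: "strictly_equivalent ?N (fiedler_prod m n A \<sigma>) (fiedler_prod m n A \<tau>)
       (pos_prod m n (\<lambda>i. - A i) r) (elem_mat m n (Neg m) (A m))"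
    using gfp_strictly_equivalent[OF m A perm inv] unfolding \<tau> by blast
  let ?F = "fiedler_prod m n A \<sigma>" and ?G = "fiedler_prod m n A \<tau>"
  have F: "?F \<in> carrier_mat ?N ?N" and G: "?G \<in> carrier_mat ?N ?N"
    using red by (auto simp: strictly_equivalent_def)
  have "set \<sigma> \<subseteq> Pos ` {0..m}" "set \<omega> \<subseteq> Pos ` {0..m}" using perm(2) by auto
  then have \<sigma>_idx: "set \<sigma> - {Pos (m - 1), Pos m} \<subseteq> Pos ` {0..<m} \<union> Neg ` {1..m}"
    and \<tau>_idx: "set \<tau> - {Neg 1, Neg 0} \<subseteq> Pos ` {0..<m} \<union> Neg ` {1..m}"
    unfolding \<tau> by force+
  have idx: "set \<sigma>1 \<subseteq> Pos ` {0..<m} \<union> Neg ` {1..m}" "set \<sigma>2 \<subseteq> Pos ` {0..<m} \<union> Neg ` {1..m}"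
    "set \<tau>1 \<subseteq> Pos ` {0..<m} \<union> Neg ` {1..m}" "set \<tau>2 \<subseteq> Pos ` {0..<m} \<union> Neg ` {1..m}"
    using E \<sigma>_idx \<tau>_idx by blast+
  have ma: "matrix_assignment n \<sigma>1 X1" "matrix_assignment n \<sigma>2 X2"
    "matrix_assignment n \<tau>1 Y1" "matrix_assignment n \<tau>2 Y2"
    using E by blast+
  obtain S1 where S1: "inv_pair ?N (elem_prod m n \<sigma>1 X1) S1"
    using elem_prod_invertible[OF m idx(1) ma(1) assms(5)] .
  obtain S2 where S2: "inv_pair ?N (elem_prod m n \<sigma>2 X2) S2"
    using elem_prod_invertible[OF m idx(2) ma(2) assms(6)] .
  obtain T1 where T1: "inv_pair ?N (elem_prod m n \<tau>1 Y1) T1"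
    using elem_prod_invertible[OF m idx(3) ma(3) assms(7)] .
  obtain T2 where T2: "inv_pair ?N (elem_prod m n \<tau>2 Y2) T2"
    using elem_prod_invertible[OF m idx(4) ma(4) assms(8)] .
  define S where "S = elem_prod m n \<tau>1 Y1 * elem_prod m n \<sigma>1 X1"
  define T where "T = elem_prod m n \<sigma>2 X2 * elem_prod m n \<tau>2 Y2"
  note S = inv_pair_mult[OF T1 S1, folded S_def] and T = inv_pair_mult[OF S2 T2, folded T_def]
  note Sc = inv_pair_carrier(1)[OF S] and Tc = inv_pair_carrier(1)[OF T]
  have L: "L = pencil (- (S * ?F * T)) (S * ?G * T)"
  proof -
    let ?x = "[:0, 1:] \<cdot>\<^sub>m const_mat ?G - const_mat ?F"
    have x: "?x = pencil (- ?F) ?G"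
      unfolding pencil_def const_mat_uminus using F G
      by (intro uminus_add_eq_minus_mat[of _ ?N ?N, symmetric]) auto
    have c: "const_mat (elem_prod m n \<sigma>2 X2) \<in> carrier_mat ?N ?N"
      "const_mat (elem_prod m n \<tau>2 Y2) \<in> carrier_mat ?N ?N"
      using inv_pair_carrier(1)[OF S2] inv_pair_carrier(1)[OF T2] by simp_all
    have xc: "const_mat S * ?x \<in> carrier_mat ?N ?N"
      unfolding x using Sc F G by (metis const_mat_carrier mult_carrier_mat pencil_carrier uminus_carrier_iff_mat)
    have "L = const_mat S * ?x * const_mat (elem_prod m n \<sigma>2 X2) * const_mat (elem_prod m n \<tau>2 Y2)"
      using E const_mat_mult[OF inv_pair_carrier(1)[OF T1] inv_pair_carrier(1)[OF S1]]
      by (simp add: S_def)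
    also have "\<dots> = const_mat S * ?x * const_mat T"
      using assoc_mult_mat[OF xc c]
        const_mat_mult[OF inv_pair_carrier(1)[OF S2] inv_pair_carrier(1)[OF T2]] by (simp add: T_def)
    also have "\<dots> = pencil (S * (- ?F) * T) (S * ?G * T)"
      unfolding x by (rule pencil_mult[OF Sc Tc _ G]) (use F in simp)
    also have "S * (- ?F) * T = - (S * ?F * T)"
      using Sc Tc F by auto
    finally show ?thesis .
  qed
  let ?X = "S * ?F * T" and ?Y = "S * ?G * T"
  have Xc: "- ?X \<in> carrier_mat ?N ?N" and Yc: "?Y \<in> carrier_mat ?N ?N"
    using Sc Tc F G by auto
  have "strictly_equivalent ?N ?F ?G ?X ?Y"
    by (rule strictly_equivalentI[OF S T F G refl refl])
  then have eq: "strictly_equivalent ?N ?X ?Y (pos_prod m n (\<lambda>i. - A i) r) (elem_mat m n (Neg m) (A m))"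
    using red by (blast intro: strictly_equivalent_trans strictly_equivalent_sym)
  have "linearization m n (mat_polynomial n m A) (pencil (- ?X) ?Y)"
    using linearizationI[OF Xc Yc]
      reduces_trans[OF strictly_equivalent_reduces(1)[OF eq] fiedler_pencil_reduces[OF m A r]] by blast
  moreover have "linearization m n (rev_mat m (mat_polynomial n m A)) (pencil ?Y (- ?X))"
    using linearizationI[OF Yc Xc]
      reduces_trans[OF strictly_equivalent_reduces(2)[OF eq] fiedler_pencil_reversal_reduces[OF m A r]] by blast
  moreover have "rev_mat 1 L = pencil ?Y (- ?X)"
    unfolding L by (rule rev_mat_pencil[OF Xc Yc])
  ultimately show ?thesis
    unfolding strong_linearization_def L by simp
qed

end
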